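(* Let $\mathbf{H}$ be a function with domain $\omega$ such that $2\le|\mathbf{H}(m)|<\omega$ for all $m$. Let $\bar\varepsilon=\langle\varepsilon_i:i<\omega\rangle$ be a decreasing sequence of positive real numbers and $\bar m=\langle m_i:i<\omega\rangle$ be a strictly increasing sequence of integers with $m_0=0$. Assume that for each $i<\omega$ $$\Big|\prod_{n<m_i}\mathbf{H}(n)\Big|\le1/\varepsilon_i.$$ Let $(K,\Sigma)$ be a good creating pair for $\mathbf{H}$ and suppose that $(K,\Sigma)$ is local, forgetful and has the $(\bar\varepsilon,\bar m)$-halving property. Then the forcing notion $\mathbb{Q}^*_\infty(K,\Sigma)$ is proper.
   Context: Convention: in forcing, the larger condition is the stronger one. $\mathbf{H}$ is a function with domain $\omega$ with $2\le|\mathbf{H}(m)|<\omega$ for all $m$. $u\vartriangleleft v$ means that the sequence $v$ extends $u$. A creature for $\mathbf{H}$ is a triple $t=(\mathbf{nor}[t],\mathbf{val}[t],\mathbf{dis}[t])$ where $\mathbf{nor}[t]\in\mathbb{R}^{\ge0}$, $\mathbf{dis}[t]$ is hereditarily countable, and for some integers $m^t_{\rm dn}<m^t_{\rm up}<\omega$, $\emptyset\ne\mathbf{val}[t]\subseteq\{\langle u,v\rangle\in\prod_{i<m^t_{\rm dn}}\mathbf{H}(i)\times\prod_{i<m^t_{\rm up}}\mathbf{H}(i):u\vartriangleleft v\}$. The family of all creatures for $\mathbf{H}$ is $\mathrm{CR}[\mathbf{H}]$. For $K\subseteq\mathrm{CR}[\mathbf{H}]$ and $\Sigma:K\to\mathcal{P}(K)$,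 $(K,\Sigma)$ is a good creating pair for $\mathbf{H}$ if for each $t\in K$: (a) $\mathrm{dom}(\mathbf{val}[t])=\prod_{i<m^t_{\rm dn}}\mathbf{H}(i)$; (b) $t\in\Sigma(t)$, and if $s\in\Sigma(t)$ then $\mathbf{val}[s]\subseteq\mathbf{val}[t]$ (so also $m^s_{\rm dn}=m^t_{\rm dn}$, $m^s_{\rm up}=m^t_{\rm up}$); (c) if $s\in\Sigma(t)$ then $\Sigma(s)\subseteq\Sigma(t)$. It is local if $m^t_{\rm up}=m^t_{\rm dn}+1$ for all $t\in K$; forgetful if for all $t\in K$, $v\in\prod_{i<m^t_{\rm up}}\mathbf{H}(i)$ and $u\in\prod_{i<m^t_{\rm dn}}\mathbf{H}(i)$, $\langle v\restriction m^t_{\rm dn},v\rangle\in\mathbf{val}[t]$ implies $\langle u,u^\frown v\restriction[m^t_{\rm dn},m^t_{\rm up})\rangle\in\mathbf{val}[t]$. For forgetful $K$ and $t\in K$, $\mathrm{pos}(t)=\{v\restriction[m^t_{\rm dn},m^t_{\rm up}):\langle v\restriction m^t_{\rm dn},v\rangle\in\mathbf{val}[t]\}$. For $t_0,\dots,t_n\in K$ with $m^{t_i}_{\rm up}=m^{t_{i+1}}_{\rm dn}$ ($i<n$) and $w\in\prod_{i<m^{t_0}_{\rm dn}}\mathbf{H}(i)$, let $\mathrm{pos}(w,t_0,\dots,t_n)=\{v\in\prod_{j<m^{t_n}_{\rm up}}\mathbf{H}(j): w\vartriangleleft v\ \&\ (\forall i\le n)(\langle v\restriction m^{t_i}_{\rm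 dn},v\restriction m^{t_i}_{\rm up}\rangle\in\mathbf{val}[t_i])\}$. Forcing $\mathbb{Q}^*_\infty(K,\Sigma)$: conditions are sequences $p=(w^p,t^p_0,t^p_1,\dots)$ with $t^p_i\in K$, $m^{t^p_i}_{\rm up}=m^{t^p_{i+1}}_{\rm dn}$ for all $i$, $w^p\in\prod_{i<m^{t^p_0}_{\rm dn}}\mathbf{H}(i)$ and $\lim_{n\to\infty}\mathbf{nor}[t^p_n]=\infty$. Order: $p\le q$ iff for some $i<\omega$, $w^q\in\mathrm{pos}(w^p,t^p_0,\dots,t^p_{i-1})$ (meaning $w^q=w^p$ if $i=0$) and $t^q_n\in\Sigma(t^p_{n+i})$ for all $n<\omega$. Halving: let $(K,\Sigma)$ be a forgetful good creating pair. For $t\in K$ and $\varepsilon>0$, a creature $t^*\in\Sigma(t)$ is an $\varepsilon$-half of $t$ if (i) $\mathbf{nor}[t^*]\ge\mathbf{nor}[t]-\varepsilon$, and (ii) whenever $s\in\Sigma(t^* )$ and $\mathbf{nor}[s]>1$, there is $t_0\in\Sigma(t)$ such that $\mathbf{nor}[t_0]\ge\mathbf{nor}[t]-\varepsilon$ and $\mathrm{pos}(t_0)\subseteq\mathrm{pos}(s)$. The pair $(K,\Sigma)$ has the $(\bar\varepsilon,\bar m)$-halving property if for every $i<\omega$ and every $t\in K$ with $m_i\le m^t_{\rm dn}$ and $\mathbf{nor}[t]\ge2$ there exists an $\varepsilon_i$-half of $t$ in $\Sigma(t)$. *)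

theory Defs
  imports Complex_Main "HOL-Library.Countable_Set_Type" "HOL-Library.Sublist"
begin

unbundle cardinal_syntax

section \<open>The universe $H(\chi)$ and elementary submodels\<close>

definition elts :: "'v rel \<Rightarrow> 'v \<Rightarrow> 'v set" where
  "elts E x = {y. (y, x) \<in> E}"

text \<open>
  For an infinite regular cardinal \<open>\<chi>\<close>, the structure $(H(\chi), \in)$ of sets hereditarily of
  cardinality $< \chi$ is, up to a unique isomorphism, the well-founded extensional structure
  in which the sets of elements of points are precisely the subsets of cardinality $< \chi$.
  Here \<open>(y, x) \<in> E\<close> stands for $y \in x$, and \<open>V\<close> is the underlying set.
\<close>

definition is_H :: "'k rel \<Rightarrow> 'v set \<Rightarrow> 'v rel \<Rightarrow> bool" where
  "is_H \<chi> V E \<longleftrightarrow>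
     E \<subseteq> V \<times> V \<and> wf E \<and>
     (\<forall>x\<in>V. \<forall>y\<in>V. elts E x = elts E y \<longrightarrow> x = y) \<and>
     (\<forall>x\<in>V. |elts E x| <o \<chi>) \<and>
     (\<forall>A. A \<subseteq> V \<and> |A| <o \<chi> \<longrightarrow> (\<exists>x\<in>V. elts E x = A))"

text \<open>First-order formulas of the language of set theory, with variables indexed by \<open>nat\<close>.\<close>

datatype fmla =
    FMem nat nat
  | FEq nat nat
  | FNeg fmla
  | FConj fmla fmla
  | FEx nat fmla

primrec sat :: "'v set \<Rightarrow> 'v rel \<Rightarrow> (nat \<Rightarrow> 'v) \<Rightarrow> fmla \<Rightarrow> bool" where
  "sat M E s (FMem i j) \<longleftrightarrow> (s i, s j) \<in> E"
| "sat M E s (FEq i j) \<longleftrightarrow> s i = s j"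
| "sat M E s (FNeg \<phi>) \<longleftrightarrow> \<not> sat M E s \<phi>"
| "sat M E s (FConj \<phi> \<psi>) \<longleftrightarrow> sat M E s \<phi> \<and> sat M E s \<psi>"
| "sat M E s (FEx i \<phi>) \<longleftrightarrow> (\<exists>x\<in>M. sat M E (s(i := x)) \<phi>)"

definition elementary_submodel :: "'v set \<Rightarrow> 'v set \<Rightarrow> 'v rel \<Rightarrow> bool" where
  "elementary_submodel N V E \<longleftrightarrow>
     N \<subseteq> V \<and> (\<forall>\<phi> s. range s \<subseteq> N \<longrightarrow> (sat N E s \<phi> \<longleftrightarrow> sat V E s \<phi>))"

text \<open>\<open>z\<close> is the Kuratowski pair of \<open>x\<close> and \<open>y\<close>.\<close>

definition is_pair :: "'v rel \<Rightarrow> 'v \<Rightarrow> 'v \<Rightarrow> 'v \<Rightarrow> bool" where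
  "is_pair E z x y \<longleftrightarrow>
     (\<exists>a b. elts E a = {x} \<and> elts E b = {x, y} \<and> elts E z = {a, b})"


section \<open>Proper forcing\<close>

text \<open>
  A forcing notion is a preorder \<open>r\<close> on a set \<open>P\<close>; \<open>(p, q) \<in> r\<close> means that \<open>q\<close> is the stronger
  condition.
\<close>

definition compatible :: "'p set \<Rightarrow> 'p rel \<Rightarrow> 'p \<Rightarrow> 'p \<Rightarrow> bool" where
  "compatible P r p q \<longleftrightarrow> (\<exists>u\<in>P. (p, u) \<in> r \<and> (q, u) \<in> r)"

definition dense_in :: "'p set \<Rightarrow> 'p rel \<Rightarrow> 'p set \<Rightarrow> bool" where
  "dense_in P r D \<longleftrightarrow> D \<subseteq> P \<and> (\<forall>p\<in>P. \<exists>d\<in>D. (p, d) \<in> r)"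

text \<open>
  A point \<open>c\<close> of the universe is a copy of the forcing notion \<open>(P, r)\<close> via \<open>e\<close> if it is the pair
  $(P', r')$ where $P'$ is the image of \<open>P\<close> under the injection \<open>e\<close> and $r'$, a set of pairs, is
  the corresponding image of \<open>r\<close>.
\<close>

definition codes_forcing ::
  "'v rel \<Rightarrow> ('p \<Rightarrow> 'v) \<Rightarrow> 'p set \<Rightarrow> 'p rel \<Rightarrow> 'v \<Rightarrow> bool" where
  "codes_forcing E e P r c \<longleftrightarrow>
     inj_on e P \<and>
     (\<exists>P' r'. is_pair E c P' r' \<and> elts E P' = e ` P \<and>
        elts E r' = {z. \<exists>p q. (p, q) \<in> r \<and> is_pair E z (e p) (e q)})"

text \<open>
  \<open>q\<close> is $(N, P)$-generic: for every dense set $D \in N$, the set $D \cap N$ is predense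
  above \<open>q\<close>.
\<close>

definition generic ::
  "'v rel \<Rightarrow> ('p \<Rightarrow> 'v) \<Rightarrow> 'p set \<Rightarrow> 'p rel \<Rightarrow> 'v set \<Rightarrow> 'p \<Rightarrow> bool" where
  "generic E e P r N q \<longleftrightarrow>
     (\<forall>d\<in>N. \<forall>D. dense_in P r D \<and> elts E d = e ` D \<longrightarrow>
        (\<forall>s\<in>P. (q, s) \<in> r \<longrightarrow> (\<exists>x\<in>D. e x \<in> N \<and> compatible P r x s)))"

text \<open>
  \<open>P\<close> is proper if for every regular uncountable $\chi > 2^{|P|}$ and every countable
  $N \prec (H(\chi), \in)$ with $P \in N$, every $p \in P \cap N$ has an $(N, P)$-generic extension.
  Since HOL has no type of all sets, $H(\chi)$ is taken over an arbitrary type \<open>'v\<close>, and $P$ is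
  replaced by an arbitrary isomorphic copy in $H(\chi)$. The cardinal \<open>\<chi>\<close> can be taken over
  \<open>'v\<close> as well because $\chi \le |H(\chi)|$. As a definition cannot quantify over types, \<open>'v\<close> is a
  parameter; a forcing notion is proper iff the predicate holds for all \<open>'v\<close>.
\<close>

definition proper_forcing :: "'v itself \<Rightarrow> 'p set \<Rightarrow> 'p rel \<Rightarrow> bool" where
  "proper_forcing _ P r \<longleftrightarrow>
     preorder_on P r \<and>
     (\<forall>(\<chi> :: 'v rel) (V :: 'v set) E e c N.
        Card_order \<chi> \<and> natLeq <o \<chi> \<and> regularCard \<chi> \<and> |Pow P| <o \<chi> \<and>
        is_H \<chi> V E \<and> codes_forcing E e P r c \<and>
        countable N \<and> elementary_submodel N V E \<and> c \<in> N \<longrightarrow>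
        (\<forall>p\<in>P. e p \<in> N \<longrightarrow> (\<exists>q\<in>P. (p, q) \<in> r \<and> generic E e P r N q)))"


section \<open>Creatures\<close>

text \<open>Hereditarily countable sets.\<close>

datatype hcset = HC (hc_elts: "hcset cset")

text \<open>Check: with membership, \<open>hcset\<close> is $H(\aleph_1)$ in the sense of \<open>is_H\<close>.\<close>

lemma hcset_is_H:
  "is_H (cardSuc natLeq) (UNIV :: hcset set) {(y, x). y \<in> rcset (hc_elts x)}"
proof -
  have wf: "wf {(y, x). y \<in> rcset (hc_elts x)}"
    unfolding wf_def
  proof (intro allI impI)
    fix P :: "hcset \<Rightarrow> bool" and x
    assume a: "\<forall>x. (\<forall>y. (y, x) \<in> {(y, x). y \<in> rcset (hc_elts x)} \<longrightarrow> P y) \<longrightarrow> P x"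
    show "P x"
    proof (induction x)
      case (HC C)
      then show ?case
        using a by (metis (no_types, lifting) case_prodD hcset.sel mem_Collect_eq)
    qed
  qed
  have c: "|A| <o cardSuc natLeq \<longleftrightarrow> countable A" for A :: "hcset set"
    unfolding countable_card_le_natLeq
    by (rule cardSuc_ordLeq_ordLess[OF natLeq_Card_order card_of_Card_order])
  have "\<exists>x. rcset (hc_elts x) = A" if "countable A" for A
    by (metis hcset.sel rcset_to_rcset that acset_inverse mem_Collect_eq)
  then show ?thesis
    unfolding is_H_def c using wf by (auto simp: elts_def hcset.expand rcset_inject)
qed

definition seqs :: "(nat \<Rightarrow> 'a set) \<Rightarrow> nat \<Rightarrow> 'a list set" where
  "seqs H m = {u. length u = m \<and> (\<forall>i<m. u ! i \<in> H i)}"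

datatype 'a creature =
  Creature (nor: real) (val: "('a list \<times> 'a list) set") (dis: hcset)

definition CR :: "(nat \<Rightarrow> 'a set) \<Rightarrow> 'a creature set" where
  "CR H = {t. 0 \<le> nor t \<and> val t \<noteq> {} \<and>
     (\<exists>dn up. dn < up \<and> val t \<subseteq> {(u, v). u \<in> seqs H dn \<and> v \<in> seqs H up \<and> prefix u v})}"

text \<open>Since \<open>val t\<close> is nonempty, $m^t_{\rm dn}$ and $m^t_{\rm up}$ are determined by it.\<close>

definition mdn :: "'a creature \<Rightarrow> nat" where
  "mdn t = the_elem (length ` Domain (val t))"

definition mup :: "'a creature \<Rightarrow> nat" where
  "mup t = the_elem (length ` Range (val t))"

lemma mdn_mup_eqI:
  assumes "val t \<noteq> {}" "val t \<subseteq> {(u, v). u \<in> seqs H dn \<and> v \<in> seqs H up \<and> prefix u v}"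
  shows "mdn t = dn" "mup t = up"
proof -
  have "length ` Domain (val t) = {dn}" "length ` Range (val t) = {up}"
    using assms by (force simp: seqs_def)+
  then show "mdn t = dn" "mup t = up"
    by (simp_all add: mdn_def mup_def)
qed

lemma CR_val:
  assumes "t \<in> CR H"
  shows "mdn t < mup t"
    and "val t \<subseteq> {(u, v). u \<in> seqs H (mdn t) \<and> v \<in> seqs H (mup t) \<and> prefix u v}"
  using assms mdn_mup_eqI[of t H] unfolding CR_def by fastforce+


section \<open>Creating pairs\<close>

definition good_creating_pair ::
  "(nat \<Rightarrow> 'a set) \<Rightarrow> 'a creature set \<Rightarrow> ('a creature \<Rightarrow> 'a creature set) \<Rightarrow> bool" where
  "good_creating_pair H K \<Sigma> \<longleftrightarrow>
     K \<subseteq> CR H \<and> (\<forall>t\<in>K. \<Sigma> t \<subseteq> K) \<and>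
     (\<forall>t\<in>K. Domain (val t) = seqs H (mdn t) \<and>
        t \<in> \<Sigma> t \<and> (\<forall>s\<in>\<Sigma> t. val s \<subseteq> val t) \<and>
        (\<forall>s\<in>\<Sigma> t. \<Sigma> s \<subseteq> \<Sigma> t))"

definition local_pair :: "'a creature set \<Rightarrow> bool" where
  "local_pair K \<longleftrightarrow> (\<forall>t\<in>K. mup t = mdn t + 1)"

definition forgetful :: "(nat \<Rightarrow> 'a set) \<Rightarrow> 'a creature set \<Rightarrow> bool" where
  "forgetful H K \<longleftrightarrow>
     (\<forall>t\<in>K. \<forall>v\<in>seqs H (mup t). \<forall>u\<in>seqs H (mdn t).
        (take (mdn t) v, v) \<in> val t \<longrightarrow> (u, u @ drop (mdn t) v) \<in> val t)"

text \<open>The final segment $v \restriction [m^t_{\rm dn}, m^t_{\rm up})$ is represented by a list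
  reindexed to start at 0.\<close>

definition pos :: "'a creature \<Rightarrow> 'a list set" where
  "pos t = {drop (mdn t) v | v. (take (mdn t) v, v) \<in> val t}"

text \<open>\<open>pos_seq H w [t\<^sub>0, \<dots>, t\<^sub>n]\<close> is $\mathrm{pos}(w, t_0, \dots, t_n)$, with the value
  $\{w\}$ for the empty sequence of creatures.\<close>

definition pos_seq :: "(nat \<Rightarrow> 'a set) \<Rightarrow> 'a list \<Rightarrow> 'a creature list \<Rightarrow> 'a list set" where
  "pos_seq H w ts =
     (if ts = [] then {w}
      else {v \<in> seqs H (mup (last ts)).
              prefix w v \<and> (\<forall>t\<in>set ts. (take (mdn t) v, take (mup t) v) \<in> val t)})"

type_synonym 'a condition = "'a list \<times> (nat \<Rightarrow> 'a creature)"

definition Q_conds :: "(nat \<Rightarrow> 'a set) \<Rightarrow> 'a creature set \<Rightarrow> 'a condition set" where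
  "Q_conds H K =
     {(w, t). (\<forall>i. t i \<in> K \<and> mup (t i) = mdn (t (Suc i))) \<and> w \<in> seqs H (mdn (t 0)) \<and>
        filterlim (\<lambda>n. nor (t n)) at_top sequentially}"

definition Q_le ::
  "(nat \<Rightarrow> 'a set) \<Rightarrow> 'a creature set \<Rightarrow> ('a creature \<Rightarrow> 'a creature set) \<Rightarrow> 'a condition rel" where
  "Q_le H K \<Sigma> =
     {((w, t), (w', t')). (w, t) \<in> Q_conds H K \<and> (w', t') \<in> Q_conds H K \<and>
        (\<exists>i. w' \<in> pos_seq H w (map t [0..<i]) \<and> (\<forall>n. t' n \<in> \<Sigma> (t (n + i))))}"

definition is_half ::
  "('a creature \<Rightarrow> 'a creature set) \<Rightarrow> real \<Rightarrow> 'a creature \<Rightarrow> 'a creature \<Rightarrow> bool" where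
  "is_half \<Sigma> \<epsilon> t t' \<longleftrightarrow>
     t' \<in> \<Sigma> t \<and> nor t' \<ge> nor t - \<epsilon> \<and>
     (\<forall>s\<in>\<Sigma> t'. nor s > 1 \<longrightarrow> (\<exists>t0\<in>\<Sigma> t. nor t0 \<ge> nor t - \<epsilon> \<and> pos t0 \<subseteq> pos s))"

definition halving_property ::
  "'a creature set \<Rightarrow> ('a creature \<Rightarrow> 'a creature set) \<Rightarrow> (nat \<Rightarrow> real) \<Rightarrow> (nat \<Rightarrow> nat) \<Rightarrow> bool" where
  "halving_property K \<Sigma> \<epsilon> m \<longleftrightarrow>
     (\<forall>i. \<forall>t\<in>K. m i \<le> mdn t \<and> nor t \<ge> 2 \<longrightarrow> (\<exists>t'\<in>\<Sigma> t. is_half \<Sigma> (\<epsilon> i) t t'))"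

end

theory Submission
  imports Defs
begin

text \<open>
  The halving property yields fusion orders, in the style of Baumgartner's Axiom A. To handle a
  dense set $D$, pick a level $m_i$ beyond which all norms are large and run through the at most
  $1/\varepsilon_i$ stems $u$ of that length. If some pure extension above $u$ that keeps the norms
  up to $\varepsilon_i$ has all its possibilities at some later level in $D$, pass to it;
  otherwise replace all creatures by $\varepsilon_i$-halves. In the second case no extension with
  stem $u$ and norms above 1 can enter $D$, since by halving its first creatures could be exchanged
  for ones of large norm. Doing this on infinitely many levels makes countably many elements of $D$
  predense.

  As nothing about a model $N$ is known except that it contains the forcing notion, the fusion orders
  have to be recovered inside $N$: that a strategy for the fusion game exists is a first-order
  statement about the forcing notion in $H(\chi)$, so by elementarity $N$ contains such a
  strategy.
\<close>

section \<open>Definability\<close>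

text \<open>The bound on the number of stems is a budget. Each stem of length \<open>m l\<close> may
  cost \<open>\<epsilon> l\<close> in norm, so all of them together cost at most 1, and norms that
  start at 3 never fall below the 2 that halving asks for. One tail of creatures can serve all these
  stems at once because a local forgetful creature amounts to a set of single letters that does not
  depend on the stem.

  Infinitely many levels are needed because a member of the dense set found above the fusion may
  have a long stem and small first norms. It is prolonged to a treated level from which on all its
  norms exceed 1; only such conditions are controlled.

  On the side of the model, the formulas can speak of the coded order but of neither norms nor
  natural numbers. A play is therefore given by the graph of its successor function. Without
  counters, a play that repeats a condition would have no such graph. The play is assembled outside
  the model from positions that all lie inside it; being countable, its graph is still a point of
  H(\<chi>), so the strategy applies to it.\<close>

primrec fv :: "fmla \<Rightarrow> nat set" where
  "fv (FMem i j) = {i, j}"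
| "fv (FEq i j) = {i, j}"
| "fv (FNeg \<phi>) = fv \<phi>"
| "fv (FConj \<phi> \<psi>) = fv \<phi> \<union> fv \<psi>"
| "fv (FEx i \<phi>) = fv \<phi> - {i}"

lemma finite_fv: "finite (fv \<phi>)"
  by (induction \<phi>) auto

lemma sat_cong_fv: "(\<And>i. i \<in> fv \<phi> \<Longrightarrow> s i = s' i) \<Longrightarrow> sat M E s \<phi> \<longleftrightarrow> sat M E s' \<phi>"
proof (induction \<phi> arbitrary: s s')
  case (FConj \<phi> \<psi>)
  have "sat M E s \<phi> \<longleftrightarrow> sat M E s' \<phi>" "sat M E s \<psi> \<longleftrightarrow> sat M E s' \<psi>"
    by (rule FConj.IH; use FConj.prems in simp)+
  then show ?case by simp
next
  case (FEx i \<phi>)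
  have "sat M E (s(i := x)) \<phi> \<longleftrightarrow> sat M E (s'(i := x)) \<phi>" for x
    by (rule FEx.IH) (use FEx.prems in auto)
  then show ?case by simp
next
  case (FNeg \<phi>)
  have "sat M E s \<phi> \<longleftrightarrow> sat M E s' \<phi>" by (rule FNeg.IH) (use FNeg.prems in simp)
  then show ?case by simp
next
  case (FMem i j)
  then have "s i = s' i" "s j = s' j" by simp_all
  then show ?case by simp
next
  case (FEq i j)
  then have "s i = s' i" "s j = s' j" by simp_all
  then show ?case by simp
qed

text \<open>Capture is avoided by moving each bound variable to some \<open>k\<close> outside the
  image of \<open>fv \<phi>\<close> under \<open>f\<close>. The map \<open>f\<close> may identify
  variables.\<close>

lemma sat_rename: "\<exists>\<psi>. \<forall>s. sat M E s \<psi> \<longleftrightarrow> sat M E (s \<circ> f) \<phi>"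
proof (induction \<phi> arbitrary: f)
  case (FMem i j)
  show ?case by (rule exI[of _ "FMem (f i) (f j)"]) simp
next
  case (FEq i j)
  show ?case by (rule exI[of _ "FEq (f i) (f j)"]) simp
next
  case (FNeg \<phi>)
  then obtain \<psi> where "\<And>s. sat M E s \<psi> \<longleftrightarrow> sat M E (s \<circ> f) \<phi>" by blast
  then show ?case by (intro exI[of _ "FNeg \<psi>"]) (simp del: o_apply)
next
  case (FConj \<phi> \<psi>)
  obtain \<phi>' where "\<And>s. sat M E s \<phi>' \<longleftrightarrow> sat M E (s \<circ> f) \<phi>" using FConj by blast
  moreover obtain \<psi>' where "\<And>s. sat M E s \<psi>' \<longleftrightarrow> sat M E (s \<circ> f) \<psi>" using FConj by blast
  ultimately show ?case by (intro exI[of _ "FConj \<phi>' \<psi>'"]) (simp del: o_apply)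
next
  case (FEx i \<phi>)
  obtain k where k: "k \<notin> f ` fv \<phi>"
    using finite_fv ex_new_if_finite[OF infinite_UNIV_nat] by blast
  obtain \<psi> where \<psi>: "\<And>s. sat M E s \<psi> \<longleftrightarrow> sat M E (s \<circ> f(i := k)) \<phi>"
    using FEx by blast
  have "sat M E (s(k := x) \<circ> f(i := k)) \<phi> \<longleftrightarrow> sat M E ((s \<circ> f)(i := x)) \<phi>" for s x
    by (rule sat_cong_fv) (use k in auto)
  then show ?case
    by (intro exI[of _ "FEx k \<psi>"]) (simp only: sat.simps \<psi> simp_thms)
qed

text \<open>Predicates on assignments take the place of formulas, so that definability of the long
  predicates below follows from their shape by introduction rules, and concrete variable names occur
  only in the proofs about quantifiers.\<close>

definition definable :: "'v set \<Rightarrow> 'v rel \<Rightarrow> ((nat \<Rightarrow> 'v) \<Rightarrow> bool) \<Rightarrow> bool" where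
  "definable V E R \<longleftrightarrow> (\<exists>\<phi>. \<forall>s. range s \<subseteq> V \<longrightarrow> (R s \<longleftrightarrow> sat V E s \<phi>))"

lemma definable_mem: "definable V E (\<lambda>s. (s i, s j) \<in> E)"
  unfolding definable_def by (rule exI[of _ "FMem i j"]) simp

lemma definable_eq: "definable V E (\<lambda>s. s i = s j)"
  unfolding definable_def by (rule exI[of _ "FEq i j"]) simp

lemma definable_not: "definable V E R \<Longrightarrow> definable V E (\<lambda>s. \<not> R s)"
  unfolding definable_def
proof (elim exE)
  fix \<phi> assume "\<forall>s. range s \<subseteq> V \<longrightarrow> (R s \<longleftrightarrow> sat V E s \<phi>)"
  then show "\<exists>\<phi>. \<forall>s. range s \<subseteq> V \<longrightarrow> (\<not> R s \<longleftrightarrow> sat V E s \<phi>)"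
    by (intro exI[of _ "FNeg \<phi>"]) (simp del: o_apply)
qed

lemma definable_conj:
  "definable V E R \<Longrightarrow> definable V E R' \<Longrightarrow> definable V E (\<lambda>s. R s \<and> R' s)"
  unfolding definable_def
proof (elim exE)
  fix \<phi> \<psi>
  assume "\<forall>s. range s \<subseteq> V \<longrightarrow> (R s \<longleftrightarrow> sat V E s \<phi>)" "\<forall>s. range s \<subseteq> V \<longrightarrow> (R' s \<longleftrightarrow> sat V E s \<psi>)"
  then show "\<exists>\<phi>. \<forall>s. range s \<subseteq> V \<longrightarrow> (R s \<and> R' s \<longleftrightarrow> sat V E s \<phi>)"
    by (intro exI[of _ "FConj \<phi> \<psi>"]) (simp del: o_apply)
qed

lemma definable_imp:
  "definable V E R \<Longrightarrow> definable V E R' \<Longrightarrow> definable V E (\<lambda>s. R s \<longrightarrow> R' s)"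
  using definable_not[OF definable_conj[OF _ definable_not]] by fastforce

text \<open>Variables are de Bruijn indices: a quantifier shifts the free variables up by one.\<close>

lemma definable_ex:
  assumes "definable V E (\<lambda>s. R (s 0) (\<lambda>n. s (Suc n)))"
  shows "definable V E (\<lambda>s. \<exists>x\<in>V. R x s)"
proof -
  obtain \<phi> where \<phi>: "\<And>s. range s \<subseteq> V \<Longrightarrow> R (s 0) (\<lambda>n. s (Suc n)) \<longleftrightarrow> sat V E s \<phi>"
    using assms unfolding definable_def by blast
  \<comment> \<open>The renaming \<open>case_nat k id\<close> sends variable 0 to \<open>k\<close>
    and undoes the shift of the others, so \<open>k\<close> must differ from every \<open>n\<close>
    with \<open>Suc n\<close> free in \<open>\<phi>\<close>.\<close>
  obtain k where k: "k \<notin> (\<lambda>n. n - 1) ` fv \<phi>"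
    using finite_fv ex_new_if_finite[OF infinite_UNIV_nat] by blast
  obtain \<psi> where \<psi>: "\<And>s. sat V E s \<psi> \<longleftrightarrow> sat V E (s \<circ> case_nat k id) \<phi>"
    using sat_rename by blast
  have "sat V E (s(k := x)) \<psi> \<longleftrightarrow> R x s" if "range s \<subseteq> V" "x \<in> V" for s x
  proof -
    have "sat V E (s(k := x) \<circ> case_nat k id) \<phi> \<longleftrightarrow> sat V E (case_nat x s) \<phi>"
    proof (rule sat_cong_fv)
      fix i assume "i \<in> fv \<phi>"
      then show "(s(k := x) \<circ> case_nat k id) i = (case_nat x s) i"
        using k by (cases i) (force simp: image_iff)+
    qed
    also have "\<dots> \<longleftrightarrow> R x s"
      using \<phi>[of "case_nat x s"] that by (auto simp: image_subset_iff split: nat.splits)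
    finally show ?thesis by (simp add: \<psi>)
  qed
  then show ?thesis
    unfolding definable_def by (intro exI[of _ "FEx k \<psi>"]) auto
qed

lemma definable_all:
  assumes "definable V E (\<lambda>s. R (s 0) (\<lambda>n. s (Suc n)))"
  shows "definable V E (\<lambda>s. \<forall>x\<in>V. R x s)"
  using definable_not[OF definable_ex[of V E "\<lambda>x s. \<not> R x s"]] definable_not[OF assms] by simp

lemma definable_cong:
  assumes "\<And>s. range s \<subseteq> V \<Longrightarrow> R s \<longleftrightarrow> R' s" "definable V E R'"
  shows "definable V E R"
proof -
  obtain \<phi> where "\<forall>s. range s \<subseteq> V \<longrightarrow> (R' s \<longleftrightarrow> sat V E s \<phi>)"
    using assms(2) unfolding definable_def by blast
  then show ?thesis
    unfolding definable_def using assms(1) by (intro exI[of _ \<phi>]) blast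
qed

lemma definable_disj:
  "definable V E R \<Longrightarrow> definable V E R' \<Longrightarrow> definable V E (\<lambda>s. R s \<or> R' s)"
  using definable_imp[OF definable_not, of V E R R'] by (simp add: disj_imp)

lemma definable_iff:
  "definable V E R \<Longrightarrow> definable V E R' \<Longrightarrow> definable V E (\<lambda>s. R s \<longleftrightarrow> R' s)"
  using definable_conj[OF definable_imp definable_imp, of V E R R' R' R] by (simp add: iff_conv_conj_imp)

lemmas definable_intros =
  definable_mem definable_eq definable_not definable_conj definable_disj definable_imp definable_iff
  definable_ex definable_all

text \<open>One half of the Tarski-Vaught criterion: elementarity carries
  \<open>FEx 0 \<phi>\<close> down to \<open>N\<close>, and then carries \<open>\<phi>\<close> at
  the witness back up, so the relation holds in \<open>V\<close> itself.\<close>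

lemma elementary_submodel_ex:
  assumes N: "elementary_submodel N V E" and s: "range s \<subseteq> N"
    and R: "definable V E (\<lambda>s. R (s 0) (\<lambda>n. s (Suc n)))" and ex: "\<exists>x\<in>V. R x s"
  shows "\<exists>x\<in>N. R x s"
proof -
  obtain \<phi> where \<phi>: "\<And>s. range s \<subseteq> V \<Longrightarrow> R (s 0) (\<lambda>n. s (Suc n)) \<longleftrightarrow> sat V E s \<phi>"
    using R unfolding definable_def by blast
  \<comment> \<open>The entry \<open>s 0\<close> is a default value in \<open>N\<close>; the
    quantifier overwrites slot 0.\<close>
  define s' where "s' = case_nat (s 0) s"
  have upd: "s'(0 := x) = case_nat x s" for x
    by (auto simp: s'_def fun_eq_iff split: nat.split)
  have NV: "N \<subseteq> V" and el: "\<And>\<phi> s. range s \<subseteq> N \<Longrightarrow> sat N E s \<phi> \<longleftrightarrow> sat V E s \<phi>"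
    using N unfolding elementary_submodel_def by auto
  have rng: "range (case_nat x s) \<subseteq> A" if "x \<in> A" "N \<subseteq> A" for x A
    using that s by (auto simp: image_subset_iff split: nat.splits)
  have "sat V E s' (FEx 0 \<phi>)"
    using ex \<phi>[OF rng[OF _ NV]] by (auto simp: upd)
  moreover have "range s' \<subseteq> N"
    unfolding s'_def by (rule rng) (use s in auto)
  ultimately have "sat N E s' (FEx 0 \<phi>)"
    using el by blast
  then obtain x where x: "x \<in> N" "sat N E (case_nat x s) \<phi>"
    by (auto simp: upd)
  then have "sat V E (case_nat x s) \<phi>"
    using el rng by blast
  then have "R x s"
    using \<phi>[OF rng[OF _ NV], of x] x NV by auto
  then show ?thesis using x by blast
qed

section \<open>Sets coded in $H(\chi)$\<close>

text \<open>Six parameters are what \<open>good_step\<close> requires, the largest case. Other uses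
  fill the spare slots with some element of \<open>N\<close>.\<close>

lemma elementary_submodel_ex6:
  assumes N: "elementary_submodel N V E" and p: "a \<in> N" "b \<in> N" "c \<in> N" "d \<in> N" "e \<in> N" "f \<in> N"
    and Q: "definable V E (\<lambda>s. Q (s 0) (s (Suc 0)) (s (Suc (Suc 0))) (s (Suc (Suc (Suc 0))))
      (s (Suc (Suc (Suc (Suc 0))))) (s (Suc (Suc (Suc (Suc (Suc 0))))))
      (s (Suc (Suc (Suc (Suc (Suc (Suc 0))))))))"
    and ex: "\<exists>x\<in>V. Q x a b c d e f"
  shows "\<exists>x\<in>N. Q x a b c d e f"
proof -
  define s where "s = case_nat a (case_nat b (case_nat c (case_nat d (case_nat e (\<lambda>_::nat. f)))))"
  have "range s \<subseteq> N"
    using p by (auto simp: s_def image_subset_iff split: nat.split)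
  from elementary_submodel_ex[OF N this, of "\<lambda>x s. Q x (s 0) (s (Suc 0)) (s (Suc (Suc 0))) (s (Suc (Suc (Suc 0))))
      (s (Suc (Suc (Suc (Suc 0))))) (s (Suc (Suc (Suc (Suc (Suc 0))))))", OF Q] ex
  show ?thesis by (simp add: s_def)
qed

locale H_universe =
  fixes \<chi> :: "'v rel" and V :: "'v set" and E :: "'v rel"
  assumes chi: "Card_order \<chi>" "natLeq <o \<chi>"
    and H: "is_H \<chi> V E"
begin

lemma E_V: "(x, y) \<in> E \<Longrightarrow> x \<in> V" "(x, y) \<in> E \<Longrightarrow> y \<in> V"
  using H by (auto simp: is_H_def)

lemma elts_V: "elts E x \<subseteq> V"
  using E_V by (auto simp: elts_def)

lemma code_small: "A \<subseteq> V \<Longrightarrow> |A| <o \<chi> \<Longrightarrow> \<exists>x\<in>V. elts E x = A"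
  using H by (auto simp: is_H_def)

lemma countable_small: "countable A \<Longrightarrow> |A| <o \<chi>"
  using chi(2) ordLeq_ordLess_trans by (auto simp: countable_card_le_natLeq)

lemma code_countable: "A \<subseteq> V \<Longrightarrow> countable A \<Longrightarrow> \<exists>x\<in>V. elts E x = A"
  using code_small countable_small by blast

lemma Times_small:
  assumes "|A| <o \<chi>" "|B| <o \<chi>" shows "|A \<times> B| <o \<chi>"
proof -
  \<comment> \<open>The summand \<open>nat\<close> makes \<open>?C\<close> infinite, so that it
    absorbs the product whether or not \<open>A\<close> and \<open>B\<close> are finite.\<close>
  let ?C = "A <+> (B <+> (UNIV :: nat set))"
  have inf: "\<not> finite (Field \<chi>)"
    using cinfinite_mono[OF ordLess_imp_ordLeq[OF chi(2)] natLeq_cinfinite] by (simp add: cinfinite_def)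
  have "|UNIV :: nat set| <o \<chi>" by (rule countable_small) simp
  then have "|?C| <o \<chi>"
    by (intro card_of_Plus_ordLess_infinite_Field[OF inf chi(1)] assms)
  moreover have "|A \<times> B| \<le>o |?C|"
  proof (rule card_of_Times_ordLeq_infinite_Field)
    have "|B| \<le>o |B <+> (UNIV :: nat set)|" by (rule card_of_Plus1)
    also have "|B <+> (UNIV :: nat set)| \<le>o |?C|" by (rule card_of_Plus2)
    finally show "|B| \<le>o |?C|" .
  qed (simp_all add: card_of_Plus1 card_of_card_order_on Field_card_of finite_Plus_iff)
  ultimately show ?thesis
    using ordLeq_ordLess_trans by blast
qed

lemma image_small: "|A| <o \<chi> \<Longrightarrow> |f ` A| <o \<chi>"
  using card_of_image ordLeq_ordLess_trans by blast

definition opair :: "'v \<Rightarrow> 'v \<Rightarrow> 'v" where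
  "opair x y = (SOME z. is_pair E z x y)"

lemma is_pair_V:
  assumes "is_pair E z x y" shows "x \<in> V" "y \<in> V" "z \<in> V"
  using assms E_V unfolding is_pair_def elts_def by blast+

lemma is_pair_inj:
  assumes "is_pair E z x y" "is_pair E z x' y'"
  shows "x = x'" "y = y'"
proof -
  obtain a b a' b' where e: "elts E a = {x}" "elts E b = {x, y}" "elts E a' = {x'}" "elts E b' = {x', y'}"
    and z: "elts E z = {a, b}" "elts E z = {a', b'}"
    using assms unfolding is_pair_def by blast
  have "{elts E a, elts E b} = elts E ` elts E z" unfolding z(1) by simp
  also have "\<dots> = {elts E a', elts E b'}" unfolding z(2) by simp
  finally have "{elts E a, elts E b} = {elts E a', elts E b'}" .
  then have "{{x}, {x, y}} = {{x'}, {x', y'}}" using e by simp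
  then show "x = x'" "y = y'" by (auto simp: doubleton_eq_iff)
qed

lemma is_pair_opair:
  assumes "x \<in> V" "y \<in> V" shows "is_pair E (opair x y) x y"
proof -
  obtain a where a: "a \<in> V" "elts E a = {x}" using code_countable[of "{x}"] assms by auto
  obtain b where b: "b \<in> V" "elts E b = {x, y}" using code_countable[of "{x, y}"] assms by auto
  obtain z where z: "elts E z = {a, b}" using code_countable[of "{a, b}"] a b by auto
  then have "is_pair E z x y" using a(2) b(2) unfolding is_pair_def by blast
  then show ?thesis unfolding opair_def by (rule someI)
qed

lemma opair_V: "x \<in> V \<Longrightarrow> y \<in> V \<Longrightarrow> opair x y \<in> V"
  using is_pair_opair is_pair_V by blast

lemma definable_is_pair: "definable V E (\<lambda>s. is_pair E (s i) (s j) (s k))"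
proof -
  have eq: "is_pair E z x y \<longleftrightarrow> (\<exists>a\<in>V. \<exists>b\<in>V. (\<forall>t\<in>V. (t, a) \<in> E \<longleftrightarrow> t = x) \<and>
      (\<forall>t\<in>V. (t, b) \<in> E \<longleftrightarrow> t = x \<or> t = y) \<and> (\<forall>t\<in>V. (t, z) \<in> E \<longleftrightarrow> t = a \<or> t = b))"
    (is "_ \<longleftrightarrow> ?R z x y")
    if "x \<in> V" "y \<in> V" for x y z
  proof
    assume "is_pair E z x y"
    then obtain a b where ab: "elts E a = {x}" "elts E b = {x, y}" "elts E z = {a, b}"
      using is_pair_def by metis
    then have "a \<in> V" "b \<in> V" using elts_V[of z] by simp_all
    moreover have "(t, a) \<in> E \<longleftrightarrow> t = x" "(t, b) \<in> E \<longleftrightarrow> t = x \<or> t = y"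
      "(t, z) \<in> E \<longleftrightarrow> t = a \<or> t = b" for t
      using ab unfolding elts_def by blast+
    ultimately show "?R z x y" by (intro bexI[of _ a] bexI[of _ b] conjI ballI)
  next
    assume "?R z x y"
    then obtain a b where ab: "a \<in> V" "b \<in> V" "\<forall>t\<in>V. (t, a) \<in> E \<longleftrightarrow> t = x"
      "\<forall>t\<in>V. (t, b) \<in> E \<longleftrightarrow> t = x \<or> t = y" "\<forall>t\<in>V. (t, z) \<in> E \<longleftrightarrow> t = a \<or> t = b"
      by blast
    then have "elts E a = {x}" "elts E b = {x, y}" "elts E z = {a, b}"
      using that E_V(1) unfolding elts_def by blast+
    then show "is_pair E z x y" unfolding is_pair_def by blast
  qed
  have "definable V E (\<lambda>s. \<exists>a\<in>V. \<exists>b\<in>V. (\<forall>t\<in>V. (t, a) \<in> E \<longleftrightarrow> t = s j) \<and>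
      (\<forall>t\<in>V. (t, b) \<in> E \<longleftrightarrow> t = s j \<or> t = s k) \<and> (\<forall>t\<in>V. (t, s i) \<in> E \<longleftrightarrow> t = a \<or> t = b))"
    by (intro definable_intros)
  then show ?thesis
    by (rule definable_cong[rotated]) (use eq in \<open>simp add: image_subset_iff\<close>)
qed

section \<open>Relations, dense sets and fusion strategies as points of H(\<chi>)\<close>

definition holds :: "'v \<Rightarrow> 'v \<Rightarrow> 'v \<Rightarrow> bool" where
  "holds g x y \<longleftrightarrow> (\<exists>z\<in>V. (z, g) \<in> E \<and> is_pair E z x y)"

definition functional :: "'v \<Rightarrow> bool" where
  "functional g \<longleftrightarrow> (\<forall>x\<in>V. \<forall>y\<in>V. \<forall>y'\<in>V. holds g x y \<and> holds g x y' \<longrightarrow> y = y')"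

definition closed_under :: "'v \<Rightarrow> 'v \<Rightarrow> bool" where
  "closed_under g Y \<longleftrightarrow> (\<forall>x\<in>V. \<forall>y\<in>V. (x, Y) \<in> E \<and> holds g x y \<longrightarrow> (y, Y) \<in> E)"

definition dense_code :: "'v \<Rightarrow> 'v \<Rightarrow> 'v \<Rightarrow> bool" where
  "dense_code P r d \<longleftrightarrow> (\<forall>x\<in>V. (x, d) \<in> E \<longrightarrow> (x, P) \<in> E) \<and>
     (\<forall>p\<in>V. (p, P) \<in> E \<longrightarrow> (\<exists>x\<in>V. (x, d) \<in> E \<and> holds r p x))"

text \<open>The next predicates say in the language of set theory that \<open>\<rho>\<close> is a strategy for the
  fusion game on \<open>(P, r)\<close>. Its states, the elements of \<open>S\<close>, are pairs of a counter and a condition;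
  the counters increase along the membership relation, so that the plays have no repetitions.\<close>

definition fusion_code :: "'v \<Rightarrow> 'v \<Rightarrow> 'v \<Rightarrow> 'v \<Rightarrow> bool" where
  "fusion_code P r \<rho> S \<longleftrightarrow> (\<forall>g\<in>V. \<forall>x0\<in>V.
     functional g \<and> (\<forall>x\<in>V. \<forall>y\<in>V. holds g x y \<longrightarrow> holds \<rho> x y) \<and> (x0, S) \<in> E \<longrightarrow>
     (\<exists>q\<in>V. (q, P) \<in> E \<and> (\<exists>Y\<in>V. (x0, Y) \<in> E \<and> closed_under g Y \<and>
        (\<forall>y\<in>V. \<forall>a\<in>V. \<forall>x\<in>V. (y, Y) \<in> E \<and> is_pair E y a x \<longrightarrow> holds r x q))))"

definition counter_code :: "'v \<Rightarrow> bool" where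
  "counter_code \<rho> \<longleftrightarrow> (\<forall>\<sigma>\<in>V. \<forall>\<sigma>'\<in>V. holds \<rho> \<sigma> \<sigma>' \<longrightarrow>
     (\<exists>a\<in>V. \<exists>x\<in>V. \<exists>a'\<in>V. \<exists>x'\<in>V. is_pair E \<sigma> a x \<and> is_pair E \<sigma>' a' x' \<and> (a, a') \<in> E))"

definition start_code :: "'v \<Rightarrow> 'v \<Rightarrow> bool" where
  "start_code P S \<longleftrightarrow> (\<forall>x\<in>V. (x, P) \<in> E \<longrightarrow> (\<exists>\<sigma>\<in>V. (\<sigma>, S) \<in> E \<and> (\<exists>a\<in>V. is_pair E \<sigma> a x)))"

text \<open>The \<open>g\<close>-orbit of \<open>x0\<close> stands for an arbitrary countable set: without mentioning $\omega$, it is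
  seen to be contained in every elementary submodel containing \<open>g\<close> and \<open>x0\<close>.\<close>

definition caught :: "'v \<Rightarrow> 'v \<Rightarrow> 'v \<Rightarrow> 'v \<Rightarrow> 'v \<Rightarrow> 'v \<Rightarrow> bool" where
  "caught P r d \<sigma> g x0 \<longleftrightarrow> functional g \<and> (\<forall>Y\<in>V. (x0, Y) \<in> E \<and> closed_under g Y \<longrightarrow>
     (\<forall>s\<in>V. (s, P) \<in> E \<and> (\<forall>a\<in>V. \<forall>x\<in>V. is_pair E \<sigma> a x \<longrightarrow> holds r x s) \<longrightarrow>
       (\<exists>x\<in>V. (x, d) \<in> E \<and> (x, Y) \<in> E \<and> (\<exists>u\<in>V. (u, P) \<in> E \<and> holds r x u \<and> holds r s u))))"

text \<open>The code \<open>g\<close>, \<open>x0\<close> of a countable predense set is bound here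
  and is no part of the move: once the move lies in \<open>N\<close>, elementarity finds a code in
  \<open>N\<close> as well.\<close>

definition good_step :: "'v \<Rightarrow> 'v \<Rightarrow> 'v \<Rightarrow> 'v \<Rightarrow> 'v \<Rightarrow> 'v \<Rightarrow> 'v \<Rightarrow> bool" where
  "good_step P r \<rho> S \<sigma> d \<sigma>' \<longleftrightarrow> (\<sigma>', S) \<in> E \<and> holds \<rho> \<sigma> \<sigma>' \<and>
     (\<exists>g\<in>V. \<exists>x0\<in>V. caught P r d \<sigma>' g x0)"

definition strategy_code :: "'v \<Rightarrow> 'v \<Rightarrow> 'v \<Rightarrow> 'v \<Rightarrow> bool" where
  "strategy_code P r \<rho> S \<longleftrightarrow> fusion_code P r \<rho> S \<and> counter_code \<rho> \<and> start_code P S \<and>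
     (\<forall>\<sigma>\<in>V. \<forall>d\<in>V. (\<sigma>, S) \<in> E \<and> dense_code P r d \<longrightarrow> (\<exists>\<sigma>'\<in>V. good_step P r \<rho> S \<sigma> d \<sigma>'))"

lemma definable_holds: "definable V E (\<lambda>s. holds (s i) (s j) (s k))"
  unfolding holds_def by (intro definable_intros definable_is_pair)

lemma definable_functional: "definable V E (\<lambda>s. functional (s i))"
  unfolding functional_def by (intro definable_intros definable_holds)

lemma definable_closed_under: "definable V E (\<lambda>s. closed_under (s i) (s j))"
  unfolding closed_under_def by (intro definable_intros definable_holds)

lemma definable_dense_code: "definable V E (\<lambda>s. dense_code (s i) (s j) (s k))"
  unfolding dense_code_def by (intro definable_intros definable_holds)

lemma definable_caught: "definable V E (\<lambda>s. caught (s i) (s j) (s k) (s l) (s m) (s n))"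
  unfolding caught_def
  by (intro definable_intros definable_holds definable_is_pair definable_functional definable_closed_under)

lemma definable_good_step: "definable V E (\<lambda>s. good_step (s i) (s j) (s k) (s l) (s m) (s n) (s n'))"
  unfolding good_step_def by (intro definable_intros definable_holds definable_caught)

lemma definable_strategy_code: "definable V E (\<lambda>s. strategy_code (s i) (s j) (s k) (s l))"
  unfolding strategy_code_def fusion_code_def counter_code_def start_code_def
  by (intro definable_intros definable_holds definable_is_pair definable_functional
      definable_closed_under definable_dense_code definable_good_step)

section \<open>Coding relations, counters and countable sets\<close>

lemma holds_iff:
  assumes "elts E g = {opair x y |x y. (x, y) \<in> G}" "G \<subseteq> V \<times> V"
  shows "holds g x y \<longleftrightarrow> (x, y) \<in> G"
proof
  assume "holds g x y"
  then obtain z where z: "(z, g) \<in> E" "is_pair E z x y" by (auto simp: holds_def)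
  then have "z \<in> {opair x y |x y. (x, y) \<in> G}" unfolding assms(1)[symmetric] elts_def by simp
  then obtain x' y' where "(x', y') \<in> G" "z = opair x' y'" by blast
  then show "(x, y) \<in> G"
    using z is_pair_opair[of x' y'] assms(2) is_pair_inj[of z x y x' y'] by auto
next
  assume "(x, y) \<in> G"
  then have "opair x y \<in> elts E g" "x \<in> V" "y \<in> V" using assms by blast+
  then show "holds g x y"
    unfolding holds_def elts_def using is_pair_opair opair_V by blast
qed

lemma code_relation:
  assumes "G \<subseteq> V \<times> V" "|G| <o \<chi>"
  shows "\<exists>g\<in>V. \<forall>x y. holds g x y \<longleftrightarrow> (x, y) \<in> G"
proof -
  have eq: "{opair x y |x y. (x, y) \<in> G} = (\<lambda>(x, y). opair x y) ` G" by auto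
  have "|{opair x y |x y. (x, y) \<in> G}| <o \<chi>" unfolding eq by (rule image_small[OF assms(2)])
  moreover have "{opair x y |x y. (x, y) \<in> G} \<subseteq> V" using assms opair_V by auto
  ultimately obtain g where "g \<in> V" "elts E g = {opair x y |x y. (x, y) \<in> G}"
    using code_small by blast
  then show ?thesis using holds_iff[OF _ assms(1)] by blast
qed

lemma holds_V: "holds g x y \<Longrightarrow> x \<in> V \<and> y \<in> V"
  using is_pair_V by (auto simp: holds_def)

text \<open>Every point belongs to some other point, for instance to its singleton, and this can be
  iterated. Such a chain replaces \<omega> as a supply of counters.\<close>

lemma ex_counters:
  assumes "V \<noteq> {}"
  shows "\<exists>\<zeta>. range \<zeta> \<subseteq> V \<and> (\<forall>n. (\<zeta> n, \<zeta> (Suc n)) \<in> E)"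
proof -
  have "\<exists>y. (x, y) \<in> E" if "x \<in> V" for x
    using code_countable[of "{x}"] that by (auto simp: elts_def)
  then obtain h where h: "\<And>x. x \<in> V \<Longrightarrow> (x, h x) \<in> E" by metis
  obtain x where "x \<in> V" using assms by blast
  then have "(h ^^ n) x \<in> V" for n by (induction n) (simp_all add: E_V(2)[OF h])
  then show ?thesis using h by (intro exI[of _ "\<lambda>n. (h ^^ n) x"]) auto
qed

lemma increasing_inj:
  assumes "\<And>n. (\<zeta> n, \<zeta> (Suc n)) \<in> E" shows "inj \<zeta>"
proof -
  have "(\<zeta> i, \<zeta> (i + Suc k)) \<in> E\<^sup>+" for i k
    by (induction k) (use assms in \<open>auto intro: trancl_into_trancl\<close>)
  moreover have "acyclic E" using H wf_acyclic by (auto simp: is_H_def)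
  ultimately have "\<zeta> i \<noteq> \<zeta> (i + Suc k)" for i k
    unfolding acyclic_def by metis
  then have "\<zeta> i \<noteq> \<zeta> j" if "i < j" for i j
    using less_imp_Suc_add[OF that] by auto
  then show ?thesis by (intro injI) (metis linorder_neqE_nat)
qed

text \<open>\<open>B\<close> is enumerated by \<open>b\<close>, and \<open>g\<close> maps each
  \<open>b n\<close> to \<open>b (Suc n)\<close>. For \<open>g\<close> to be a function,
  \<open>b\<close> has to be injective; a chain of counters is added to \<open>B\<close> so that an
  injective enumeration exists even if \<open>B\<close> is finite.\<close>

lemma countable_in_orbit:
  assumes "V \<noteq> {}" "B \<subseteq> V" "countable B"
  shows "\<exists>g\<in>V. \<exists>x0\<in>V. functional g \<and>
    (\<forall>Y. (x0, Y) \<in> E \<and> closed_under g Y \<longrightarrow> B \<subseteq> elts E Y)"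
proof -
  obtain \<zeta> where \<zeta>: "range \<zeta> \<subseteq> V" "\<And>n. (\<zeta> n, \<zeta> (Suc n)) \<in> E" using ex_counters assms(1) by auto
  have "infinite (B \<union> range \<zeta>)" using increasing_inj[of \<zeta>, OF \<zeta>(2)] range_inj_infinite by blast
  moreover have "countable (B \<union> range \<zeta>)" using assms by auto
  ultimately obtain b :: "nat \<Rightarrow> 'v" where b: "bij_betw b UNIV (B \<union> range \<zeta>)"
    using bij_betw_from_nat_into by blast
  have inj: "inj b" and rng: "range b = B \<union> range \<zeta>" using b unfolding bij_betw_def by blast+
  have bV: "b n \<in> V" for n using rng \<zeta>(1) assms(2) by blast
  have "countable (range (\<lambda>n. (b n, b (Suc n))))" by simp
  then obtain g where g: "g \<in> V" "\<And>x y. holds g x y \<longleftrightarrow> (x, y) \<in> range (\<lambda>n. (b n, b (Suc n)))"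
    using code_relation[OF _ countable_small, of "range (\<lambda>n. (b n, b (Suc n)))"] bV by blast
  have "functional g"
    unfolding functional_def g(2) using inj by (auto dest: injD)
  moreover have "B \<subseteq> elts E Y" if Y: "(b 0, Y) \<in> E" "closed_under g Y" for Y
  proof -
    have "(b n, Y) \<in> E" for n
    proof (induction n)
      case (Suc n)
      have "holds g (b n) (b (Suc n))" unfolding g(2) by blast
      then show ?case using Suc Y(2) bV unfolding closed_under_def by blast
    qed (use Y in simp)
    then have "range b \<subseteq> elts E Y" by (auto simp: elts_def)
    then show ?thesis using rng by blast
  qed
  ultimately show ?thesis using g(1) bV by blast
qed

end

section \<open>Fusion implies properness\<close>

locale forcing_copy = H_universe \<chi> V E for \<chi> :: "'v rel" and V :: "'v set" and E :: "'v rel" +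
  fixes e :: "'p \<Rightarrow> 'v" and P :: "'p set" and r :: "'p rel" and c P' r' :: 'v
  assumes pre: "preorder_on P r"
    and inj: "inj_on e P"
    and c: "is_pair E c P' r'" and P': "elts E P' = e ` P"
    and r': "elts E r' = {z. \<exists>p q. (p, q) \<in> r \<and> is_pair E z (e p) (e q)}"
begin

lemma r_P: "(p, q) \<in> r \<Longrightarrow> p \<in> P \<and> q \<in> P"
  using pre by (auto simp: preorder_on_def)

lemma r_tr: "(p, q) \<in> r \<Longrightarrow> (q, s) \<in> r \<Longrightarrow> (p, s) \<in> r"
  using pre by (auto simp: preorder_on_def dest: transD)

lemma e_V: "p \<in> P \<Longrightarrow> e p \<in> V"
  using P' elts_V by blast

lemma mem_P': "(x, P') \<in> E \<longleftrightarrow> (\<exists>p\<in>P. x = e p)"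
  using P' by (auto simp: elts_def)

lemma mem_P'_e: "p \<in> P \<Longrightarrow> (e p, P') \<in> E"
  using mem_P' by blast

lemma holds_r':
  assumes "p \<in> P" "q \<in> P"
  shows "holds r' (e p) (e q) \<longleftrightarrow> (p, q) \<in> r"
proof
  assume "holds r' (e p) (e q)"
  then obtain z where z: "z \<in> elts E r'" "is_pair E z (e p) (e q)"
    unfolding holds_def elts_def by blast
  then obtain p1 q1 where pq: "(p1, q1) \<in> r" "is_pair E z (e p1) (e q1)" unfolding r' by blast
  then have "e p = e p1" "e q = e q1" using z(2) is_pair_inj by blast+
  then have "p = p1" "q = q1" using r_P[OF pq(1)] assms inj_onD[OF inj] by blast+
  then show "(p, q) \<in> r" using pq(1) by simp
next
  assume pq: "(p, q) \<in> r"
  have z: "is_pair E (opair (e p) (e q)) (e p) (e q)" using assms e_V is_pair_opair by blast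
  then have "opair (e p) (e q) \<in> elts E r'" unfolding r' using pq by blast
  then show "holds r' (e p) (e q)"
    using z is_pair_V(3)[OF z] unfolding holds_def elts_def by blast
qed

lemma dense_codeI:
  assumes D: "elts E d = e ` D" and a: "dense_in P r D"
  shows "dense_code P' r' d"
proof -
  have d: "(x, d) \<in> E \<longleftrightarrow> (\<exists>p\<in>D. x = e p)" for x using D by (auto simp: elts_def)
  show "dense_code P' r' d"
    unfolding dense_code_def
  proof (intro conjI ballI impI)
    fix x assume "(x, d) \<in> E"
    then show "(x, P') \<in> E" using a unfolding d mem_P' dense_in_def by blast
  next
    fix y assume "(y, P') \<in> E"
    then obtain p where p: "p \<in> P" "y = e p" unfolding mem_P' by blast
    then obtain x where x: "x \<in> D" "(p, x) \<in> r" using a by (auto simp: dense_in_def)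
    then have "holds r' y (e x)" using holds_r' p r_P by blast
    then show "\<exists>x\<in>V. (x, d) \<in> E \<and> holds r' y x" using x(1) d holds_V by blast
  qed
qed

lemma dense_code_dense:
  assumes "dense_code P' r' d"
  shows "\<exists>D. elts E d = e ` D \<and> dense_in P r D"
proof -
  define D where "D = {p \<in> P. (e p, d) \<in> E}"
  have "x \<in> e ` D" if "(x, d) \<in> E" for x
  proof -
    have "(x, P') \<in> E" using that assms E_V(1) unfolding dense_code_def by blast
    then show ?thesis using that unfolding mem_P' D_def by blast
  qed
  then have d: "elts E d = e ` D" by (auto simp: elts_def D_def)
  have "\<exists>x\<in>D. (p, x) \<in> r" if p: "p \<in> P" for p
  proof -
    obtain x where x: "(x, d) \<in> E" "holds r' (e p) x"
      using assms mem_P'_e[OF p] e_V[OF p] unfolding dense_code_def by blast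
    then obtain q where "q \<in> D" "x = e q" using d by (auto simp: elts_def)
    then show ?thesis using x holds_r' p unfolding D_def by blast
  qed
  then show ?thesis using d unfolding dense_in_def D_def by blast
qed

text \<open>The strategy is played against an enumeration of all dense sets in \<open>N\<close>,
  with all moves taken in \<open>N\<close>. A bound \<open>q\<close> of the play is generic: each
  dense set \<open>d j\<close> in \<open>N\<close> has a countable subset that is predense above the
  condition of state \<open>Suc j\<close>, hence above \<open>q\<close>, and that is contained in
  \<open>N\<close>, since it lies in an orbit of a function in \<open>N\<close>.\<close>

lemma generic_extension:
  assumes N: "elementary_submodel N V E" "countable N" "c \<in> N"
    and ex: "\<exists>\<rho>\<in>V. \<exists>S\<in>V. strategy_code P' r' \<rho> S"
    and p: "p \<in> P" "e p \<in> N"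
  shows "\<exists>q\<in>P. (p, q) \<in> r \<and> generic E e P r N q"
proof -
  have NV: "N \<subseteq> V" using N by (simp add: elementary_submodel_def)
  note el = elementary_submodel_ex6[OF N(1)]
  have PrV: "P' \<in> V" "r' \<in> V" using is_pair_V[OF c] by blast+
  \<comment> \<open>The components of the pair \<open>c\<close> are definable from \<open>c\<close>,
    so they belong to \<open>N\<close>.\<close>
  have "\<exists>x\<in>N. \<exists>y\<in>V. is_pair E c x y"
    by (rule el[where Q = "\<lambda>x a _ _ _ _ _. \<exists>y\<in>V. is_pair E a x y", OF N(3) N(3) N(3) N(3) N(3) N(3)])
      (intro definable_intros definable_is_pair, use c PrV in blast)
  then have PN: "P' \<in> N" using is_pair_inj[OF c] by blast
  have "\<exists>y\<in>N. is_pair E c P' y"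
    by (rule el[where Q = "\<lambda>x a b _ _ _ _. is_pair E a b x", OF N(3) PN PN PN PN PN])
      (intro definable_intros definable_is_pair, use c PrV in blast)
  then have rN: "r' \<in> N" using is_pair_inj[OF c] by blast
  have "\<exists>\<rho>\<in>N. \<exists>S\<in>V. strategy_code P' r' \<rho> S"
    by (rule el[where Q = "\<lambda>x a b _ _ _ _. \<exists>S\<in>V. strategy_code a b x S", OF PN rN rN rN rN rN])
      (intro definable_intros definable_strategy_code, rule ex)
  then obtain \<rho> where \<rho>: "\<rho> \<in> N" "\<exists>S\<in>V. strategy_code P' r' \<rho> S" by blast
  have "\<exists>S\<in>N. strategy_code P' r' \<rho> S"
    by (rule el[where Q = "\<lambda>x a b c _ _ _. strategy_code a b c x", OF PN rN \<rho>(1) rN rN rN])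
      (rule definable_strategy_code, rule \<rho>(2))
  then obtain S where S: "S \<in> N" "strategy_code P' r' \<rho> S" by blast
  have fus: "fusion_code P' r' \<rho> S" and cnt: "counter_code \<rho>" and start: "start_code P' S"
    and step: "\<And>\<sigma> d. \<sigma> \<in> V \<Longrightarrow> d \<in> V \<Longrightarrow> (\<sigma>, S) \<in> E \<Longrightarrow> dense_code P' r' d \<Longrightarrow> \<exists>\<sigma>'\<in>V. good_step P' r' \<rho> S \<sigma> d \<sigma>'"
    using S(2) unfolding strategy_code_def by blast+
  \<comment> \<open>Being countable, \<open>N\<close> is itself coded by a point. It will be the
    closed set \<open>Y\<close> in \<open>caught\<close>.\<close>
  obtain n where n: "n \<in> V" "elts E n = N" using code_countable[OF NV N(2)] by blast
  have nN: "(x, n) \<in> E \<longleftrightarrow> x \<in> N" for x using n(2) by (auto simp: elts_def)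
  have "\<exists>\<sigma>\<in>V. (\<sigma>, S) \<in> E \<and> (\<exists>a\<in>V. is_pair E \<sigma> a (e p))"
    using start mem_P'_e[OF p(1)] e_V[OF p(1)] unfolding start_code_def by blast
  have "\<exists>\<sigma>\<in>N. (\<sigma>, S) \<in> E \<and> (\<exists>a\<in>V. is_pair E \<sigma> a (e p))"
    by (rule el[where Q = "\<lambda>x a b _ _ _ _. (x, a) \<in> E \<and> (\<exists>y\<in>V. is_pair E x y b)", OF S(1) p(2) rN rN rN rN])
      (intro definable_intros definable_is_pair, fact)
  then obtain \<sigma>0 a0 where \<sigma>0: "\<sigma>0 \<in> N" "(\<sigma>0, S) \<in> E" "is_pair E \<sigma>0 a0 (e p)" by blast
  have gs: "\<exists>\<sigma>'\<in>N. good_step P' r' \<rho> S \<sigma> d \<sigma>'"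
    if "\<sigma> \<in> N" "d \<in> N" "(\<sigma>, S) \<in> E" "dense_code P' r' d" for \<sigma> d
    by (rule el[where Q = "\<lambda>x a b c d e f. good_step a b c d e f x", OF PN rN \<rho>(1) S(1) that(1,2)])
      (rule definable_good_step, use step that NV in blast)
  have caughtN: "\<exists>g\<in>N. \<exists>x\<in>N. caught P' r' d \<sigma> g x" if "good_step P' r' \<rho> S \<sigma>' d \<sigma>" "\<sigma> \<in> N" "d \<in> N" for \<sigma> \<sigma>' d
  proof -
    have "\<exists>g\<in>V. \<exists>x\<in>V. caught P' r' d \<sigma> g x" using that(1) unfolding good_step_def by blast
    have "\<exists>g\<in>N. \<exists>x\<in>V. caught P' r' d \<sigma> g x"
      by (rule el[where Q = "\<lambda>x a b c d _ _. \<exists>y\<in>V. caught a b c d x y", OF PN rN that(3,2) rN rN])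
        (intro definable_intros definable_caught, fact)
    then obtain g where g: "g \<in> N" "\<exists>x\<in>V. caught P' r' d \<sigma> g x" by blast
    have "\<exists>x\<in>N. caught P' r' d \<sigma> g x"
      by (rule el[where Q = "\<lambda>x a b c d e _. caught a b c d e x", OF PN rN that(3,2) g(1) rN])
        (rule definable_caught, rule g(2))
    then show ?thesis using g(1) by blast
  qed
  \<comment> \<open>The value of \<open>g\<close> at a point of \<open>N\<close> is definable from
    \<open>g\<close> and that point, hence in \<open>N\<close>.\<close>
  have closedN: "closed_under g n" if g: "g \<in> N" "functional g" for g
    unfolding closed_under_def nN
  proof (intro ballI impI, elim conjE)
    fix x y assume x: "x \<in> N" and xy: "holds g x y" "x \<in> V" "y \<in> V"
    have "\<exists>y\<in>V. holds g x y" using xy by blast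
    have "\<exists>y\<in>N. holds g x y"
      by (rule el[where Q = "\<lambda>y a b _ _ _ _. holds a b y", OF g(1) x rN rN rN rN])
        (rule definable_holds, fact)
    then obtain y' where "y' \<in> N" "holds g x y'" by blast
    then show "y \<in> N" using g(2) xy NV unfolding functional_def by blast
  qed
  define DN where "DN = {d \<in> N. dense_code P' r' d}"
  have "countable DN" unfolding DN_def using N(2) by simp
  \<comment> \<open>The whole forcing notion is dense, so \<open>DN\<close> is nonempty and can be
    enumerated by \<open>nat\<close>.\<close>
  moreover have "P' \<in> DN"
    using PN dense_codeI[of P' P] P' pre
    by (auto simp: DN_def dense_in_def preorder_on_def refl_on_def)
  ultimately obtain d :: "nat \<Rightarrow> 'v" where d: "range d = DN"
    using uncountable_def by (metis empty_iff)
  have dN: "d j \<in> N" "dense_code P' r' (d j)" for j using d unfolding DN_def by blast+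
  define nxt where "nxt j \<sigma> = (SOME \<sigma>'. \<sigma>' \<in> N \<and> good_step P' r' \<rho> S \<sigma> (d j) \<sigma>')" for j \<sigma>
  define \<sigma> where "\<sigma> = rec_nat \<sigma>0 nxt"
  have \<sigma>_0: "\<sigma> 0 = \<sigma>0" and \<sigma>_Suc: "\<sigma> (Suc j) = nxt j (\<sigma> j)" for j by (simp_all add: \<sigma>_def)
  have nxt: "nxt j x \<in> N \<and> good_step P' r' \<rho> S x (d j) (nxt j x)" if "x \<in> N" "(x, S) \<in> E" for j x
  proof -
    have "\<exists>\<sigma>'. \<sigma>' \<in> N \<and> good_step P' r' \<rho> S x (d j) \<sigma>'"
      using gs[OF that(1) dN(1) that(2) dN(2)] by blast
    then show ?thesis unfolding nxt_def by (rule someI_ex)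
  qed
  have \<sigma>N: "\<sigma> j \<in> N \<and> (\<sigma> j, S) \<in> E" for j
  proof (induction j)
    case (Suc j)
    then show ?case using nxt[of "\<sigma> j" j] unfolding \<sigma>_Suc good_step_def by blast
  qed (simp add: \<sigma>_0 \<sigma>0)
  have \<sigma>s: "good_step P' r' \<rho> S (\<sigma> j) (d j) (\<sigma> (Suc j))" for j
    using nxt \<sigma>N unfolding \<sigma>_Suc by blast
  have \<sigma>V: "\<sigma> j \<in> V" for j using \<sigma>N NV by blast
  have \<sigma>\<rho>: "holds \<rho> (\<sigma> j) (\<sigma> (Suc j))" for j using \<sigma>s unfolding good_step_def by blast
  have cn: "\<exists>a x a' x'. is_pair E (\<sigma> j) a x \<and> is_pair E (\<sigma> (Suc j)) a' x' \<and> (a, a') \<in> E" for j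
    using cnt \<sigma>V \<sigma>\<rho> unfolding counter_code_def by blast
  then have "\<forall>j. \<exists>a x. is_pair E (\<sigma> j) a x" by blast
  then obtain a x where ax: "\<And>j. is_pair E (\<sigma> j) (a j) (x j)"
    unfolding choice_iff by blast
  have aE: "(a j, a (Suc j)) \<in> E" for j
    using cn[of j] is_pair_inj(1)[OF ax[of j]] is_pair_inj(1)[OF ax[of "Suc j"]] by blast
  have inj\<sigma>: "inj \<sigma>"
  proof (rule injI)
    fix i j assume "\<sigma> i = \<sigma> j"
    then have "a i = a j" using is_pair_inj(1)[OF ax[of i]] ax[of j] by metis
    then show "i = j" using increasing_inj[of a, OF aE] by (simp add: inj_eq)
  qed
  have "countable (range (\<lambda>j. (\<sigma> j, \<sigma> (Suc j))))" by simp
  then obtain g where g: "g \<in> V" "\<And>x y. holds g x y \<longleftrightarrow> (x, y) \<in> range (\<lambda>j. (\<sigma> j, \<sigma> (Suc j)))"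
    using code_relation[OF _ countable_small, of "range (\<lambda>j. (\<sigma> j, \<sigma> (Suc j)))"] \<sigma>V by blast
  have "functional g"
    unfolding functional_def g(2) using inj\<sigma> by (auto dest: injD)
  moreover have "\<forall>x\<in>V. \<forall>y\<in>V. holds g x y \<longrightarrow> holds \<rho> x y"
    unfolding g(2) using \<sigma>\<rho> by blast
  ultimately obtain q' Y where q': "(q', P') \<in> E" and Y: "(\<sigma> 0, Y) \<in> E" "closed_under g Y"
    and q'Y: "\<And>y a x. y \<in> V \<Longrightarrow> a \<in> V \<Longrightarrow> x \<in> V \<Longrightarrow> (y, Y) \<in> E \<Longrightarrow> is_pair E y a x \<Longrightarrow> holds r' x q'"
    using fus[unfolded fusion_code_def, rule_format, OF g(1) \<sigma>V[of 0]] \<sigma>N[of 0] by metis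
  obtain q where q: "q \<in> P" "q' = e q" using q' mem_P' by blast
  have "(\<sigma> j, Y) \<in> E" for j
  proof (induction j)
    case (Suc j)
    have "holds g (\<sigma> j) (\<sigma> (Suc j))" unfolding g(2) by blast
    then show ?case using Suc Y(2) \<sigma>V unfolding closed_under_def by blast
  qed (rule Y(1))
  then have xq: "holds r' (x j) (e q)" for j
    using q'Y[OF \<sigma>V _ _ _ ax] is_pair_V[OF ax] q(2) by blast
  have "x 0 = e p" using is_pair_inj(2) ax[of 0] \<sigma>0(3) \<sigma>_0 by metis
  then have "(p, q) \<in> r" using xq[of 0] holds_r' p(1) q(1) by simp
  moreover have "generic E e P r N q"
    unfolding generic_def
  proof (intro ballI allI impI, elim conjE)
    fix b D s
    assume b: "b \<in> N" and D: "dense_in P r D" "elts E b = e ` D" and s: "s \<in> P" "(q, s) \<in> r"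
    \<comment> \<open>The set \<open>d j\<close> is answered by the move from
      \<open>\<sigma> j\<close>, so it is state \<open>Suc j\<close> that catches it.\<close>
    have "b \<in> DN" using b dense_codeI[OF D(2,1)] by (simp add: DN_def)
    then obtain j where j: "b = d j" using d by blast
    obtain h x0 where h: "h \<in> N" "x0 \<in> N" "caught P' r' b (\<sigma> (Suc j)) h x0"
      using caughtN[OF \<sigma>s] \<sigma>N b j by blast
    have "closed_under h n" using closedN h unfolding caught_def by blast
    moreover have "holds r' y (e s)" if "is_pair E (\<sigma> (Suc j)) a' y" for a' y
    proof -
      have y: "y = x (Suc j)" using is_pair_inj(2)[OF that ax] .
      obtain z where z: "z \<in> elts E r'" "is_pair E z y (e q)"
        using xq[of "Suc j"] y unfolding holds_def elts_def by blast
      then obtain y0 q0 where "(y0, q0) \<in> r" "is_pair E z (e y0) (e q0)" unfolding r' by blast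
      then have y0: "y = e y0" "y0 \<in> P" using is_pair_inj(1)[OF z(2)] r_P by blast+
      then have "(y0, q) \<in> r" using xq[of "Suc j"] y holds_r' q(1) by simp
      then show ?thesis using y0 holds_r' r_tr s by blast
    qed
    ultimately obtain y u where y: "(y, b) \<in> E" "(y, n) \<in> E" and u: "(u, P') \<in> E" "holds r' y u" "holds r' (e s) u"
      using h(3) n(1) h(2) e_V[OF s(1)] mem_P'_e[OF s(1)] nN unfolding caught_def by meson
    obtain y' where y': "y' \<in> D" "y = e y'" using y(1) D(2) by (auto simp: elts_def)
    obtain u' where u': "u' \<in> P" "u = e u'" using u(1) mem_P' by blast
    have "y' \<in> P" using y' D(1) by (auto simp: dense_in_def)
    then have "compatible P r y' s"
      unfolding compatible_def using u' u(2,3) y' holds_r' s(1) by blast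
    then show "\<exists>x\<in>D. e x \<in> N \<and> compatible P r x s"
      using y' y(2) nN by blast
  qed
  ultimately show ?thesis using q(1) by blast
qed

text \<open>A state carries an index \<open>n\<close>, coded by the counter
  \<open>\<zeta> n\<close>, because the next move has to respect \<open>R n\<close>. A play may
  begin at any state; this is why \<open>fus\<close> is assumed from every index on.\<close>

lemma ex_strategy_code:
  fixes R :: "nat \<Rightarrow> 'p rel"
  assumes card: "|P| <o \<chi>" and ne: "V \<noteq> {}"
    and refl: "\<And>n p. p \<in> P \<Longrightarrow> (p, p) \<in> R n" and sub: "\<And>n. R n \<subseteq> r"
    and fus: "\<And>f n. (\<And>j. (f j, f (Suc j)) \<in> R (n + j)) \<Longrightarrow> \<exists>q\<in>P. \<forall>j. (f j, q) \<in> r"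
    and pred: "\<And>p n D. p \<in> P \<Longrightarrow> dense_in P r D \<Longrightarrow> \<exists>q B. (p, q) \<in> R n \<and> B \<subseteq> D \<and> countable B \<and>
      (\<forall>s\<in>P. (q, s) \<in> r \<longrightarrow> (\<exists>x\<in>B. compatible P r x s))"
  shows "\<exists>\<rho>\<in>V. \<exists>S\<in>V. strategy_code P' r' \<rho> S"
proof -
  obtain \<zeta> where \<zeta>: "range \<zeta> \<subseteq> V" "\<And>n. (\<zeta> n, \<zeta> (Suc n)) \<in> E" using ex_counters[OF ne] by auto
  have \<zeta>V: "\<zeta> n \<in> V" for n using \<zeta> by blast
  define st where "st x = opair (\<zeta> (fst x)) (e (snd x))" for x
  define T where "T = (UNIV :: nat set) \<times> P"
  have st: "is_pair E (st x) (\<zeta> (fst x)) (e (snd x))" if "x \<in> T" for x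
    unfolding st_def using is_pair_opair \<zeta>V e_V that by (auto simp: T_def)
  then have stV: "st x \<in> V" if "x \<in> T" for x using is_pair_V(3) that by blast
  have st_inj: "x = y" if "x \<in> T" "y \<in> T" "st x = st y" for x y
  proof -
    have "\<zeta> (fst x) = \<zeta> (fst y)" "e (snd x) = e (snd y)"
      using st[OF that(1)] st[OF that(2)] that(3) is_pair_inj by metis+
    then have "fst x = fst y" "snd x = snd y"
      using increasing_inj[of \<zeta>, OF \<zeta>(2)] inj that(1,2) by (auto simp: T_def dest: injD inj_onD)
    then show ?thesis by (rule prod_eqI)
  qed
  have T_small: "|T| <o \<chi>" unfolding T_def by (intro Times_small countable_small card) simp
  obtain S where S: "S \<in> V" "elts E S = st ` T"
    using code_small[OF _ image_small[OF T_small]] stV by blast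
  define G where "G = {(x, y). x \<in> T \<and> y \<in> T \<and> fst y = Suc (fst x) \<and> (snd x, snd y) \<in> R (fst x)}"
  have "|map_prod st st ` (T \<times> T)| <o \<chi>" by (intro image_small Times_small T_small)
  moreover have "map_prod st st ` G \<subseteq> map_prod st st ` (T \<times> T)" by (auto simp: G_def)
  ultimately have "|map_prod st st ` G| <o \<chi>"
    using card_of_mono1 ordLeq_ordLess_trans by blast
  moreover have "map_prod st st ` G \<subseteq> V \<times> V" using stV by (auto simp: G_def)
  ultimately obtain \<rho> where \<rho>: "\<rho> \<in> V" "\<And>x y. holds \<rho> x y \<longleftrightarrow> (x, y) \<in> map_prod st st ` G"
    using code_relation by blast
  have memS: "(y, S) \<in> E \<longleftrightarrow> (\<exists>x\<in>T. y = st x)" for y using S(2) by (auto simp: elts_def)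
  have "fusion_code P' r' \<rho> S"
    unfolding fusion_code_def
  proof (intro ballI impI, elim conjE)
    fix g y0
    assume g: "functional g" "\<forall>x\<in>V. \<forall>y\<in>V. holds g x y \<longrightarrow> holds \<rho> x y" and y0: "(y0, S) \<in> E"
    obtain x0 where x0: "x0 \<in> T" "y0 = st x0" using y0 memS by blast
    \<comment> \<open>The given \<open>g\<close> may be partial. Where it has no value, the play
      goes on by repeating the condition with the next counter, which reflexivity of
      \<open>R n\<close> permits; thus \<open>fus\<close> applies to an infinite sequence.\<close>
    define nx where "nx x = (if \<exists>y. holds g (st x) (st y) \<and> (x, y) \<in> G
      then SOME y. holds g (st x) (st y) \<and> (x, y) \<in> G else (Suc (fst x), snd x))" for x
    have nxG: "(x, nx x) \<in> G" if "x \<in> T" for x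
    proof (cases "\<exists>y. holds g (st x) (st y) \<and> (x, y) \<in> G")
      case True
      from someI_ex[OF this] show ?thesis using True by (simp add: nx_def)
    next
      case False
      then show ?thesis using that refl by (auto simp: nx_def G_def T_def)
    qed
    have nxg: "y = st (nx x)" if x: "x \<in> T" and xy: "holds g (st x) y" for x y
    proof -
      have "holds \<rho> (st x) y" using xy g(2) holds_V by blast
      then obtain x' z where z: "(x', z) \<in> G" "st x = st x'" "y = st z" using \<rho>(2) by auto
      then have "x' = x" using st_inj x by (auto simp: G_def)
      then have ex: "\<exists>z. holds g (st x) (st z) \<and> (x, z) \<in> G" using z xy by blast
      from someI_ex[OF this] have "holds g (st x) (st (nx x))" using ex by (simp add: nx_def)
      then show ?thesis using g(1) xy holds_V unfolding functional_def by blast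
    qed
    define f where "f j = (nx ^^ j) x0" for j
    have fT: "f j \<in> T" for j
      by (induction j) (use x0 nxG in \<open>auto simp: f_def G_def\<close>)
    have fG: "(f j, f (Suc j)) \<in> G" for j using nxG[OF fT[of j]] by (simp add: f_def)
    have "fst (f j) = fst x0 + j" for j
      by (induction j) (use fG in \<open>auto simp: G_def f_def\<close>)
    then have "(snd (f j), snd (f (Suc j))) \<in> R (fst x0 + j)" for j
      using fG[of j] by (simp add: G_def)
    from fus[OF this] obtain q where q: "q \<in> P" "\<And>j. (snd (f j), q) \<in> r" by blast
    have "range (\<lambda>j. st (f j)) \<subseteq> V" using stV[OF fT] by blast
    then obtain Y where Y: "Y \<in> V" "elts E Y = range (\<lambda>j. st (f j))"
      using code_countable[of "range (\<lambda>j. st (f j))"] by blast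
    have memY: "(y, Y) \<in> E \<longleftrightarrow> (\<exists>j. y = st (f j))" for y using Y(2) by (auto simp: elts_def)
    have "(y0, Y) \<in> E" unfolding memY x0(2) by (intro exI[of _ 0]) (simp add: f_def)
    moreover have "closed_under g Y"
      unfolding closed_under_def memY
    proof (intro ballI impI, elim conjE exE)
      fix x y j assume "holds g x y" "x = st (f j)"
      then have "y = st (f (Suc j))" using nxg[OF fT] by (simp add: f_def)
      then show "\<exists>j. y = st (f j)" by blast
    qed
    moreover have "holds r' x (e q)" if y: "(y, Y) \<in> E" "is_pair E y a x" for y a x
    proof -
      obtain j where j: "y = st (f j)" using y(1) memY by blast
      then have "x = e (snd (f j))" using st[OF fT[of j]] y(2) is_pair_inj(2) by blast
      then show ?thesis using q holds_r' r_P by blast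
    qed
    ultimately show "\<exists>q\<in>V. (q, P') \<in> E \<and> (\<exists>Y\<in>V. (y0, Y) \<in> E \<and> closed_under g Y \<and>
        (\<forall>y\<in>V. \<forall>a\<in>V. \<forall>x\<in>V. (y, Y) \<in> E \<and> is_pair E y a x \<longrightarrow> holds r' x q))"
      using q(1) e_V mem_P'_e Y(1) by blast
  qed
  moreover have "counter_code \<rho>"
    unfolding counter_code_def
  proof (intro ballI impI)
    fix s s' assume "holds \<rho> s s'"
    then obtain x y where xy: "(x, y) \<in> G" "s = st x" "s' = st y" using \<rho>(2) by auto
    then have T: "x \<in> T" "y \<in> T" and "fst y = Suc (fst x)" by (auto simp: G_def)
    then have "(\<zeta> (fst x), \<zeta> (fst y)) \<in> E" using \<zeta>(2) by simp
    then show "\<exists>a\<in>V. \<exists>x\<in>V. \<exists>a'\<in>V. \<exists>x'\<in>V. is_pair E s a x \<and> is_pair E s' a' x' \<and> (a, a') \<in> E"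
      using st[OF T(1)] st[OF T(2)] is_pair_V unfolding xy(2,3) by blast
  qed
  moreover have "start_code P' S"
    unfolding start_code_def
  proof (intro ballI impI)
    fix x assume "(x, P') \<in> E"
    then obtain p where p: "p \<in> P" "x = e p" using mem_P' by blast
    then have T0: "(0, p) \<in> T" by (simp add: T_def)
    have "is_pair E (st (0, p)) (\<zeta> 0) x" using st[OF T0] p(2) by simp
    then show "\<exists>\<sigma>\<in>V. (\<sigma>, S) \<in> E \<and> (\<exists>a\<in>V. is_pair E \<sigma> a x)"
      using stV[OF T0] memS T0 \<zeta>V by blast
  qed
  moreover have "\<exists>s'\<in>V. good_step P' r' \<rho> S s d s'"
    if s: "(s, S) \<in> E" and d: "dense_code P' r' d" for s d
  proof -
    obtain x where x: "x \<in> T" "s = st x" using s memS by blast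
    obtain D where D: "elts E d = e ` D" "dense_in P r D" using dense_code_dense[OF d] by blast
    have "snd x \<in> P" using x by (auto simp: T_def)
    from pred[OF this D(2)] obtain q B where q: "(snd x, q) \<in> R (fst x)" and B: "B \<subseteq> D" "countable B"
      and pre_B: "\<And>s. s \<in> P \<Longrightarrow> (q, s) \<in> r \<Longrightarrow> \<exists>x\<in>B. compatible P r x s"
      by metis
    define y where "y = (Suc (fst x), q)"
    have qP: "q \<in> P" using q sub r_P by blast
    then have yT: "y \<in> T" by (simp add: y_def T_def)
    have xy: "(x, y) \<in> G" using x yT q by (simp add: G_def y_def)
    have DP: "D \<subseteq> P" using D(2) by (simp add: dense_in_def)
    have "e ` B \<subseteq> V" using B DP e_V by blast
    then obtain g x0 where g: "g \<in> V" "x0 \<in> V" "functional g"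
      "\<And>Y. (x0, Y) \<in> E \<Longrightarrow> closed_under g Y \<Longrightarrow> e ` B \<subseteq> elts E Y"
      using countable_in_orbit[OF ne _ countable_image[OF B(2)]] by metis
    have "caught P' r' d (st y) g x0"
      unfolding caught_def
    proof (intro conjI ballI impI g(3), elim conjE)
      fix Y s
      assume Y: "(x0, Y) \<in> E" "closed_under g Y" and "(s, P') \<in> E"
        and sy: "\<forall>a\<in>V. \<forall>x\<in>V. is_pair E (st y) a x \<longrightarrow> holds r' x s"
      then obtain p where p: "p \<in> P" "s = e p" using mem_P' by blast
      have "holds r' (e q) s"
        using sy st[OF yT] is_pair_V[OF st[OF yT]] by (auto simp: y_def)
      then have "(q, p) \<in> r" using holds_r' qP p by simp
      then obtain b where b: "b \<in> B" "compatible P r b p" using pre_B p(1) by blast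
      then obtain u where u: "u \<in> P" "(b, u) \<in> r" "(p, u) \<in> r" by (auto simp: compatible_def)
      then have "holds r' (e b) (e u)" "holds r' s (e u)" using holds_r' r_P p by blast+
      moreover have "(e b, d) \<in> E" using b(1) B(1) D(1) by (auto simp: elts_def)
      moreover have "(e b, Y) \<in> E" using g(4)[OF Y] b(1) by (auto simp: elts_def)
      ultimately show "\<exists>x\<in>V. (x, d) \<in> E \<and> (x, Y) \<in> E \<and> (\<exists>u\<in>V. (u, P') \<in> E \<and> holds r' x u \<and> holds r' s u)"
        using E_V(1) mem_P'_e[OF u(1)] by blast
    qed
    moreover have "holds \<rho> s (st y)" unfolding \<rho>(2) x(2) using xy by force
    ultimately show ?thesis
      unfolding good_step_def using g(1,2) yT stV memS by blast
  qed
  ultimately have "strategy_code P' r' \<rho> S" unfolding strategy_code_def by blast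
  then show ?thesis using \<rho>(1) S(1) by blast
qed

end

text \<open>Baumgartner's Axiom A in a weak form, with \<open>R n\<close> in the role of the \<open>n\<close>-th fusion order.\<close>

lemma proper_forcing_if_fusion:
  fixes P :: "'p set" and R :: "nat \<Rightarrow> 'p rel"
  assumes pre: "preorder_on P r"
    and refl: "\<And>n p. p \<in> P \<Longrightarrow> (p, p) \<in> R n" and sub: "\<And>n. R n \<subseteq> r"
    and fus: "\<And>f n. (\<And>j. (f j, f (Suc j)) \<in> R (n + j)) \<Longrightarrow> \<exists>q\<in>P. \<forall>j. (f j, q) \<in> r"
    and pred: "\<And>p n D. p \<in> P \<Longrightarrow> dense_in P r D \<Longrightarrow> \<exists>q B. (p, q) \<in> R n \<and> B \<subseteq> D \<and> countable B \<and>
      (\<forall>s\<in>P. (q, s) \<in> r \<longrightarrow> (\<exists>x\<in>B. compatible P r x s))"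
  shows "proper_forcing TYPE('v) P r"
  unfolding proper_forcing_def
proof (intro conjI pre allI impI ballI, elim conjE)
  fix \<chi> :: "'v rel" and V :: "'v set" and E :: "'v rel" and e :: "'p \<Rightarrow> 'v" and c N p
  assume \<chi>: "Card_order \<chi>" "natLeq <o \<chi>" "|Pow P| <o \<chi>" and H: "is_H \<chi> V E"
    and code: "codes_forcing E e P r c" and N: "countable N" "elementary_submodel N V E" "c \<in> N"
    and p: "p \<in> P" "e p \<in> N"
  obtain P' r' where copy: "inj_on e P" "is_pair E c P' r'" "elts E P' = e ` P"
    "elts E r' = {z. \<exists>p q. (p, q) \<in> r \<and> is_pair E z (e p) (e q)}"
    using code unfolding codes_forcing_def by blast
  interpret forcing_copy \<chi> V E e P r c P' r'
    by unfold_locales (use \<chi> H pre copy in auto)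
  have "|P| <o \<chi>"
    using ordLess_transitive[OF card_of_Pow \<chi>(3)] .
  moreover have "V \<noteq> {}" using is_pair_V(3)[OF copy(2)] by blast
  ultimately have "\<exists>\<rho>\<in>V. \<exists>S\<in>V. strategy_code P' r' \<rho> S"
    by (rule ex_strategy_code[of R]) (fact refl sub fus pred)+
  then show "\<exists>q\<in>P. (p, q) \<in> r \<and> generic E e P r N q"
    using generic_extension N p by blast
qed

section \<open>Creatures of a local forgetful pair\<close>

lemma length_seqs: "u \<in> seqs H n \<Longrightarrow> length u = n"
  by (simp add: seqs_def)

lemma finite_seqs:
  assumes "\<And>n. finite (H n)"
  shows "finite (seqs H n)"
proof -
  have "seqs H n \<subseteq> {xs. set xs \<subseteq> (\<Union>i<n. H i) \<and> length xs = n}"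
    by (force simp: seqs_def in_set_conv_nth)
  then show ?thesis
    by (rule finite_subset) (use assms in \<open>auto intro: finite_lists_length_eq\<close>)
qed

locale creating_pair =
  fixes H :: "nat \<Rightarrow> 'a set" and K :: "'a creature set" and \<Sigma> :: "'a creature \<Rightarrow> 'a creature set"
  assumes finH: "\<And>n. finite (H n)"
    and good: "good_creating_pair H K \<Sigma>"
    and loc: "local_pair K"
    and forg: "forgetful H K"
begin

lemma Sigma_K: "t \<in> K \<Longrightarrow> s \<in> \<Sigma> t \<Longrightarrow> s \<in> K"
  using good by (auto simp: good_creating_pair_def)

lemma Sigma_refl: "t \<in> K \<Longrightarrow> t \<in> \<Sigma> t"
  using good by (auto simp: good_creating_pair_def)

lemma Sigma_trans: "t \<in> K \<Longrightarrow> s \<in> \<Sigma> t \<Longrightarrow> s' \<in> \<Sigma> s \<Longrightarrow> s' \<in> \<Sigma> t"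
  using good unfolding good_creating_pair_def by blast

lemma Sigma_val: "t \<in> K \<Longrightarrow> s \<in> \<Sigma> t \<Longrightarrow> val s \<subseteq> val t"
  using good unfolding good_creating_pair_def by blast

lemma val_K:
  assumes "t \<in> K"
  shows "val t \<subseteq> {(u, v). u \<in> seqs H (mdn t) \<and> v \<in> seqs H (Suc (mdn t)) \<and> prefix u v}"
  using CR_val(2)[of t H] assms good loc by (auto simp: good_creating_pair_def local_pair_def)

lemma val_nonempty: "t \<in> K \<Longrightarrow> val t \<noteq> {}"
  using good by (auto simp: good_creating_pair_def CR_def)

lemma Sigma_mdn:
  assumes "t \<in> K" "s \<in> \<Sigma> t"
  shows "mdn s = mdn t"
proof -
  have s: "s \<in> K" using assms Sigma_K by blast
  obtain u v where uv: "(u, v) \<in> val s" using val_nonempty[OF s] by fastforce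
  then have "u \<in> seqs H (mdn s)" "u \<in> seqs H (mdn t)"
    using val_K[OF s] val_K[OF assms(1)] Sigma_val[OF assms] by blast+
  then show ?thesis
    using length_seqs by metis
qed

text \<open>Locality leaves one new letter, and forgetfulness makes the admissible letters the same
  over every \<open>u\<close>.\<close>

lemma mem_pos_iff:
  assumes t: "t \<in> K" and u: "u \<in> seqs H (mdn t)"
  shows "[a] \<in> pos t \<longleftrightarrow> (u, u @ [a]) \<in> val t"
proof
  assume "[a] \<in> pos t"
  then obtain v where v: "[a] = drop (mdn t) v" "(take (mdn t) v, v) \<in> val t"
    by (auto simp: pos_def)
  then have "v \<in> seqs H (mup t)"
    using val_K[OF t] t loc by (auto simp: local_pair_def)
  then show "(u, u @ [a]) \<in> val t"
    using forg t u v unfolding forgetful_def by metis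
next
  assume "(u, u @ [a]) \<in> val t"
  then show "[a] \<in> pos t"
    unfolding pos_def using length_seqs[OF u] by (intro CollectI exI[of _ "u @ [a]"]) auto
qed

lemma pos_H:
  assumes "t \<in> K" "[a] \<in> pos t" shows "a \<in> H (mdn t)"
proof -
  obtain u v where "(u, v) \<in> val t" using val_nonempty assms by fastforce
  then have u: "u \<in> seqs H (mdn t)" using val_K assms by blast
  then have "(u, u @ [a]) \<in> val t" using mem_pos_iff assms by blast
  then have "u @ [a] \<in> seqs H (Suc (mdn t))" using val_K assms by blast
  then show ?thesis using length_seqs[OF u] by (auto simp: seqs_def nth_append)
qed

lemma pos_mono: "t \<in> K \<Longrightarrow> s \<in> \<Sigma> t \<Longrightarrow> pos s \<subseteq> pos t"
  using Sigma_val[of t s] Sigma_mdn[of t s] by (auto simp: pos_def)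

lemma pos_nonempty:
  assumes "t \<in> K" shows "\<exists>a. [a] \<in> pos t"
proof -
  obtain u v where uv: "(u, v) \<in> val t" using val_nonempty assms by fastforce
  then have l: "u \<in> seqs H (mdn t)" "v \<in> seqs H (Suc (mdn t))" "prefix u v"
    using val_K assms by blast+
  then obtain y where y: "v = u @ y" by (auto simp: prefix_def)
  then have "length y = 1" using length_seqs[OF l(1)] length_seqs[OF l(2)] by simp
  then obtain a where "y = [a]" by (auto simp: length_Suc_conv)
  then show ?thesis using mem_pos_iff assms l uv y by blast
qed

text \<open>The creatures of a condition without its stem; by locality the one with index
  \<open>i\<close> lives on level \<open>l + i\<close>. Only the length of the stem is fixed, so
  that one tail can be combined with all stems of length \<open>l\<close>.\<close>

definition tail :: "nat \<Rightarrow> (nat \<Rightarrow> 'a creature) \<Rightarrow> bool" where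
  "tail l t \<longleftrightarrow> (\<forall>i. t i \<in> K \<and> mdn (t i) = l + i) \<and> filterlim (\<lambda>n. nor (t n)) at_top sequentially"

lemma tail_K: "tail l t \<Longrightarrow> t i \<in> K"
  by (simp add: tail_def)

lemma tail_shift:
  assumes "tail l t" shows "tail (l + n) (\<lambda>i. t (i + n))"
  using assms filterlim_compose[OF _ filterlim_add_const_nat_at_top, of "\<lambda>n. nor (t n)" at_top n]
  by (auto simp: tail_def)

lemma tail_nor:
  assumes "tail l t" shows "\<exists>n. \<forall>k\<ge>n. b \<le> nor (t k)"
  using assms by (auto simp: tail_def filterlim_at_top eventually_sequentially)

abbreviation P where "P \<equiv> Q_conds H K"
abbreviation r where "r \<equiv> Q_le H K \<Sigma>"

lemma P_iff: "(w, t) \<in> P \<longleftrightarrow> w \<in> seqs H (length w) \<and> tail (length w) t"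
proof
  assume a: "(w, t) \<in> P"
  then have K: "\<And>i. t i \<in> K" and s': "\<And>i. mup (t i) = mdn (t (Suc i))" and w: "w \<in> seqs H (mdn (t 0))"
    by (auto simp: Q_conds_def)
  have s: "mdn (t (Suc i)) = Suc (mdn (t i))" for i
    using loc K[of i] s'[of i] by (simp add: local_pair_def)
  have "mdn (t i) = length w + i" for i
    by (induction i) (simp_all add: s length_seqs[OF w])
  then have "tail (length w) t"
    using a by (simp add: tail_def Q_conds_def)
  then show "w \<in> seqs H (length w) \<and> tail (length w) t"
    using w by (simp add: length_seqs[OF w])
qed (use loc in \<open>auto simp: tail_def Q_conds_def local_pair_def\<close>)

text \<open>For conditions this agrees with \<open>pos_seq\<close> (see
  \<open>pos_seq_eq_ext\<close>). As a product of sets of letters it is visibly monotone in the sets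
  \<open>pos (t i)\<close>.\<close>

definition ext :: "'a list \<Rightarrow> (nat \<Rightarrow> 'a creature) \<Rightarrow> nat \<Rightarrow> 'a list set" where
  "ext w t n = {w @ y |y. length y = n \<and> (\<forall>i<n. [y ! i] \<in> pos (t i))}"

lemma length_ext: "v \<in> ext w t n \<Longrightarrow> length v = length w + n"
  by (auto simp: ext_def)

lemma ext_seqs:
  assumes "w \<in> seqs H (length w)" "tail (length w) t" "v \<in> ext w t n"
  shows "v \<in> seqs H (length w + n)"
proof -
  obtain y where y: "v = w @ y" "length y = n" "\<And>i. i < n \<Longrightarrow> [y ! i] \<in> pos (t i)"
    using assms by (auto simp: ext_def)
  have "y ! i \<in> H (length w + i)" if "i < n" for i
    using pos_H[of "t i" "y ! i"] y(3)[OF that] assms(2) by (auto simp: tail_def)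
  then have "v ! i \<in> H i" if "i < length w + n" for i
    using assms(1) y(1) that less_diff_conv2[of "length w" i n]
    by (cases "i < length w") (force simp: seqs_def nth_append)+
  then show ?thesis
    using y by (simp add: seqs_def)
qed

lemma pos_seq_eq_ext:
  assumes w: "w \<in> seqs H (length w)" and t: "tail (length w) t"
  shows "pos_seq H w (map t [0..<n]) = ext w t n"
proof (cases "n = 0")
  case True
  then show ?thesis by (auto simp: pos_seq_def ext_def)
next
  case False
  have K: "t i \<in> K" and dn: "mdn (t i) = length w + i" and up: "mup (t i) = Suc (length w + i)" for i
    using t loc by (auto simp: tail_def local_pair_def)
  have lst: "last (map t [0..<n]) = t (n - 1)"
    using False by (simp add: last_map)
  have step: "(take (mdn (t i)) (w @ y), take (mup (t i)) (w @ y)) \<in> val (t i) \<longleftrightarrow> [y ! i] \<in> pos (t i)"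
    if y: "w @ y \<in> seqs H (length w + n)" "i < n" for y i
  proof -
    have ly: "length y = n" using y by (simp add: seqs_def)
    have "take (length w + i) (w @ y) \<in> seqs H (mdn (t i))"
      using y ly by (simp add: seqs_def dn del: take_append)
    from mem_pos_iff[OF K this, of "y ! i"] show ?thesis
      using y ly by (simp add: dn up take_Suc_conv_app_nth Suc_diff_le)
  qed
  show ?thesis
  proof (intro set_eqI iffI)
    fix v assume "v \<in> pos_seq H w (map t [0..<n])"
    then have v: "v \<in> seqs H (length w + n)" "prefix w v"
      "\<And>i. i < n \<Longrightarrow> (take (mdn (t i)) v, take (mup (t i)) v) \<in> val (t i)"
      using False lst up by (auto simp: pos_seq_def)
    then obtain y where y: "v = w @ y" by (auto simp: prefix_def)
    then have "length y = n" using v by (simp add: seqs_def)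
    then show "v \<in> ext w t n"
      using v step y by (auto simp: ext_def)
  next
    fix v assume v: "v \<in> ext w t n"
    then have s: "v \<in> seqs H (length w + n)" using ext_seqs w t by blast
    obtain y where y: "v = w @ y" "length y = n" "\<And>i. i < n \<Longrightarrow> [y ! i] \<in> pos (t i)"
      using v by (auto simp: ext_def)
    then show "v \<in> pos_seq H w (map t [0..<n])"
      using False lst up s step by (auto simp: pos_seq_def)
  qed
qed

lemma r_iff:
  "((w, t), (w', t')) \<in> r \<longleftrightarrow>
    (w, t) \<in> P \<and> (w', t') \<in> P \<and> (\<exists>n. w' \<in> ext w t n \<and> (\<forall>i. t' i \<in> \<Sigma> (t (i + n))))"
  using pos_seq_eq_ext by (auto simp: Q_le_def P_iff)

text \<open>The hypothesis compares \<open>pos\<close> and not \<Sigma>, because halving yields a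
  creature with fewer possibilities than \<open>s\<close> that need not belong to
  \<open>\<Sigma> s\<close>.\<close>

lemma ext_mono:
  assumes "v \<in> ext w s n" "\<And>i. pos (s i) \<subseteq> pos (t i)"
  shows "v \<in> ext w t n"
  using assms unfolding ext_def by blast

lemma ext_ext:
  assumes "v \<in> ext w t n" "v' \<in> ext v (\<lambda>i. t (i + n)) n'"
  shows "v' \<in> ext w t (n + n')"
proof -
  obtain y y' where y: "v = w @ y" "length y = n" "\<forall>i<n. [y ! i] \<in> pos (t i)"
    and y': "v' = v @ y'" "length y' = n'" "\<forall>i<n'. [y' ! i] \<in> pos (t (i + n))"
    using assms by (auto simp: ext_def)
  have "[(y @ y') ! i] \<in> pos (t i)" if "i < n + n'" for i
    using y y' that y'(3)[rule_format, of "i - n"] by (cases "i < n") (auto simp: nth_append)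
  then show ?thesis
    unfolding ext_def using y y' by (intro CollectI exI[of _ "y @ y'"]) auto
qed

lemma ext_exists: "tail l t \<Longrightarrow> \<exists>v. v \<in> ext w t n"
proof (induction n)
  case 0
  then show ?case by (auto simp: ext_def)
next
  case (Suc n)
  then obtain v where v: "v \<in> ext w t n" by blast
  obtain a where a: "[a] \<in> pos (t n)" using pos_nonempty tail_K Suc by blast
  have "v @ [a] \<in> ext v (\<lambda>i. t (i + n)) 1"
    using a by (auto simp: ext_def)
  then show ?case using ext_ext[OF v] by fastforce
qed

lemma P_ext:
  assumes "(w, t) \<in> P" "v \<in> ext w t n"
  shows "(v, \<lambda>i. t (i + n)) \<in> P"
proof -
  have "w \<in> seqs H (length w)" "tail (length w) t" using assms(1) P_iff by blast+
  then have "v \<in> seqs H (length v)" "tail (length v) (\<lambda>i. t (i + n))"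
    unfolding length_ext[OF assms(2)] using assms(2) ext_seqs tail_shift by blast+
  then show ?thesis using P_iff by blast
qed

lemma r_ext:
  assumes "(w, t) \<in> P" "v \<in> ext w t n"
  shows "((w, t), (v, \<lambda>i. t (i + n))) \<in> r"
proof -
  have "t (i + n) \<in> \<Sigma> (t (i + n))" for i
    using assms(1) P_iff tail_K Sigma_refl by blast
  then show ?thesis
    using assms P_ext unfolding r_iff by blast
qed

lemma ext_0: "w \<in> ext w t 0"
  by (simp add: ext_def)

lemma r_pure:
  assumes "(w, t) \<in> P" "(w, t') \<in> P" "\<And>i. t' i \<in> \<Sigma> (t i)"
  shows "((w, t), (w, t')) \<in> r"
  unfolding r_iff using assms ext_0[of w t] by (intro conjI exI[of _ 0]) simp_all

lemma r_trans: "trans r"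
proof (rule transI)
  fix p p' p'' assume a: "(p, p') \<in> r" "(p', p'') \<in> r"
  obtain w t w' t' w'' t'' where e: "p = (w, t)" "p' = (w', t')" "p'' = (w'', t'')"
    by (metis surj_pair)
  obtain n where n: "w' \<in> ext w t n" "\<And>i. t' i \<in> \<Sigma> (t (i + n))"
    using a(1) unfolding e r_iff by blast
  obtain n' where n': "w'' \<in> ext w' t' n'" "\<And>i. t'' i \<in> \<Sigma> (t' (i + n'))"
    using a(2) unfolding e r_iff by blast
  have P: "(w, t) \<in> P" "(w'', t'') \<in> P" using a unfolding e r_iff by blast+
  have K: "t i \<in> K" for i using P P_iff tail_K by blast
  have "w'' \<in> ext w' (\<lambda>i. t (i + n)) n'"
    by (rule ext_mono[OF n'(1)]) (use n K pos_mono in auto)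
  then have "w'' \<in> ext w t (n + n')" using ext_ext n by blast
  moreover have "t'' i \<in> \<Sigma> (t (i + (n + n')))" for i
    using n'(2)[of i] n(2)[of "i + n'"] K Sigma_trans by (simp add: add.assoc add.commute[of n'])
  ultimately show "(p, p'') \<in> r" unfolding e r_iff using P by blast
qed

lemma r_preorder: "preorder_on P r"
proof -
  have "(p, p) \<in> r" if "p \<in> P" for p
    using r_ext[of "fst p" "snd p", OF _ ext_0] that by simp
  then show ?thesis
    using r_trans by (auto simp: preorder_on_def refl_on_def Q_le_def)
qed

lemma r_subset: "r \<subseteq> P \<times> P"
  by (auto simp: Q_le_def)

end

section \<open>Halving and fusion\<close>

context creating_pair
begin

text \<open>A dense set need not be closed under extension; this is its closure, and the members of
  \<open>D\<close> below are chosen afterwards.\<close>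

definition above :: "'a condition set \<Rightarrow> 'a condition set" where
  "above D = {s. \<exists>x\<in>D. (x, s) \<in> r}"

lemma above_mono: "s \<in> above D \<Longrightarrow> (s, s') \<in> r \<Longrightarrow> s' \<in> above D"
  using r_trans by (auto simp: above_def dest: transD)

definition captured ::
  "'a condition set \<Rightarrow> real \<Rightarrow> 'a list \<Rightarrow> (nat \<Rightarrow> 'a creature) \<Rightarrow> (nat \<Rightarrow> 'a creature) \<Rightarrow> bool" where
  "captured D a u t t' \<longleftrightarrow> tail (length u) t' \<and> (\<forall>i. t' i \<in> \<Sigma> (t i) \<and> a \<le> nor (t' i)) \<and>
     (\<exists>n. \<forall>v\<in>ext u t' n. (v, \<lambda>i. t' (i + n)) \<in> above D)"

text \<open>The common outcome of both cases of the construction: \<open>B\<close> is finite if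
  \<open>u\<close> could be captured and empty after halving. The bound 1 on the norms is the one in
  the definition of a half.\<close>

definition settled ::
  "'a condition set \<Rightarrow> 'a list \<Rightarrow> (nat \<Rightarrow> 'a creature) \<Rightarrow> 'a condition set \<Rightarrow> bool" where
  "settled D u t B \<longleftrightarrow> (\<forall>s. (u, s) \<in> above D \<and> (\<forall>i. s i \<in> \<Sigma> (t i) \<and> 1 < nor (s i)) \<longrightarrow>
     (\<exists>x\<in>B. compatible P r x (u, s)))"

lemma above_P: "s \<in> above D \<Longrightarrow> s \<in> P"
  using r_subset by (auto simp: above_def)

text \<open>Later shrinking of the creatures only leaves fewer \<open>s\<close> to consider, so the
  stems can be treated one after another.\<close>

lemma settled_mono:
  assumes "settled D u t B" "tail l t" "\<And>i. t' i \<in> \<Sigma> (t i)" "B \<subseteq> B'"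
  shows "settled D u t' B'"
proof -
  have "s i \<in> \<Sigma> (t i)" if "s i \<in> \<Sigma> (t' i)" for s i
    using that assms(2,3) tail_K Sigma_trans by blast
  then show ?thesis
    using assms(1,4) unfolding settled_def by blast
qed

text \<open>There are finitely many possibilities \<open>v\<close> at the capturing level; one
  member of \<open>D\<close> is picked for each. A pure extension \<open>(u, s)\<close> passes
  through one of these \<open>v\<close>, and from there on it extends the member picked for
  \<open>v\<close>.\<close>

lemma captured_settled:
  assumes u: "u \<in> seqs H (length u)" and cap: "captured D a u t t'"
  shows "\<exists>B\<subseteq>D. finite B \<and> settled D u t' B"
proof -
  obtain n where t': "tail (length u) t'" and n: "\<And>v. v \<in> ext u t' n \<Longrightarrow> (v, \<lambda>i. t' (i + n)) \<in> above D"
    using cap unfolding captured_def by blast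
  have fin: "finite (ext u t' n)"
    using ext_seqs[OF u t'] finite_seqs[OF finH] by (meson finite_subset subsetI)
  obtain x where x: "\<And>v. v \<in> ext u t' n \<Longrightarrow> x v \<in> D \<and> (x v, (v, \<lambda>i. t' (i + n))) \<in> r"
    using n unfolding above_def mem_Collect_eq by metis
  have "settled D u t' (x ` ext u t' n)"
    unfolding settled_def
  proof (intro allI impI, elim conjE)
    fix s assume s: "(u, s) \<in> above D" "\<forall>i. s i \<in> \<Sigma> (t' i) \<and> 1 < nor (s i)"
    have sP: "(u, s) \<in> P" using s above_P by blast
    then obtain v where v: "v \<in> ext u s n" using ext_exists P_iff by blast
    have v': "v \<in> ext u t' n"
      by (rule ext_mono[OF v]) (use s t' pos_mono tail_K in blast)
    have "((v, \<lambda>i. t' (i + n)), (v, \<lambda>i. s (i + n))) \<in> r"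
      by (rule r_pure) (use x[OF v'] r_subset P_ext[OF sP v] s in auto)
    then have "(x v, (v, \<lambda>i. s (i + n))) \<in> r"
      using x[OF v'] r_trans by (meson transD)
    then show "\<exists>x\<in>x ` ext u t' n. compatible P r x (u, s)"
      unfolding compatible_def using r_ext[OF sP v] P_ext[OF sP v] v' by blast
  qed
  then show ?thesis using x fin by blast
qed

end

locale halving_pair = creating_pair +
  fixes \<epsilon> :: "nat \<Rightarrow> real" and m :: "nat \<Rightarrow> nat"
  assumes eps_pos: "\<And>i. 0 < \<epsilon> i"
    and m_mono: "strict_mono m"
    and card_le: "\<And>i. real (card (seqs H (m i))) \<le> 1 / \<epsilon> i"
    and halving: "halving_property K \<Sigma> \<epsilon> m"
begin

text \<open>If no extension is captured, halve all creatures: a small extension of the halves above \<open>D\<close>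
  could be blown up on finitely many levels, where its norms are too small, without adding
  possibilities, and the result would be captured.\<close>

lemma settle_one:
  assumes t: "tail (m l) t" and a: "2 \<le> a" "\<And>i. a \<le> nor (t i)" and u: "u \<in> seqs H (m l)"
  shows "\<exists>t' B. tail (m l) t' \<and> (\<forall>i. t' i \<in> \<Sigma> (t i) \<and> a - \<epsilon> l \<le> nor (t' i)) \<and> B \<subseteq> D \<and> finite B \<and>
    settled D u t' B"
proof (cases "\<exists>t'. captured D (a - \<epsilon> l) u t t'")
  case True
  then obtain t' where t': "captured D (a - \<epsilon> l) u t t'" by blast
  have lu: "length u = m l" using u length_seqs by blast
  show ?thesis
    using captured_settled[OF _ t'] t' u unfolding captured_def lu by blast
next
  case False
  have lu: "length u = m l" using u length_seqs by blast
  have dn: "mdn (t i) = m l + i" and K: "t i \<in> K" for i using t by (auto simp: tail_def)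
  have "\<exists>t'. is_half \<Sigma> (\<epsilon> l) (t i) t'" for i
    using halving K[of i] dn[of i] a(2)[of i] a(1) unfolding halving_property_def by force
  then obtain h where h: "\<And>i. is_half \<Sigma> (\<epsilon> l) (t i) (h i)" by metis
  then have hS: "h i \<in> \<Sigma> (t i)" and hn: "nor (t i) - \<epsilon> l \<le> nor (h i)" for i
    by (auto simp: is_half_def)
  have "filterlim (\<lambda>i. nor (t i)) at_top sequentially" using t by (simp add: tail_def)
  then have "filterlim (\<lambda>i. - \<epsilon> l + nor (t i)) at_top sequentially"
    by (rule filterlim_tendsto_add_at_top[OF tendsto_const])
  then have "filterlim (\<lambda>i. nor (h i)) at_top sequentially"
    by (rule filterlim_at_top_mono) (use hn in auto)
  then have tl: "tail (m l) h"
    unfolding tail_def using Sigma_K Sigma_mdn K hS dn by metis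
  \<comment> \<open>With \<open>B\<close> empty, this says that no such \<open>s\<close> exists:
    each one would produce a captured \<open>t'\<close>.\<close>
  have "settled D u h {}"
    unfolding settled_def
  proof (intro allI impI, elim conjE)
    fix s assume s: "(u, s) \<in> above D" "\<forall>i. s i \<in> \<Sigma> (h i) \<and> 1 < nor (s i)"
    have sP: "(u, s) \<in> P" using s above_P by blast
    then have st: "tail (m l) s" using P_iff lu by auto
    obtain n where n: "\<And>k. n \<le> k \<Longrightarrow> a - \<epsilon> l \<le> nor (s k)" using tail_nor[OF st] by blast
    have "\<exists>t0\<in>\<Sigma> (t i). nor (t i) - \<epsilon> l \<le> nor t0 \<and> pos t0 \<subseteq> pos (s i)" for i
      using h[of i] s(2) by (auto simp: is_half_def)
    then obtain t0 where t0: "\<And>i. t0 i \<in> \<Sigma> (t i)" "\<And>i. nor (t i) - \<epsilon> l \<le> nor (t0 i)"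
      "\<And>i. pos (t0 i) \<subseteq> pos (s i)" by metis
    define t' where "t' i = (if i < n then t0 i else s i)" for i
    have t'S: "t' i \<in> \<Sigma> (t i)" for i
      using t0 s(2) Sigma_trans[OF K hS] by (simp add: t'_def)
    have t'n: "a - \<epsilon> l \<le> nor (t' i)" for i
      using t0(2)[of i] a(2)[of i] n[of i] by (auto simp: t'_def)
    have "filterlim (\<lambda>i. nor (s i)) at_top sequentially" using st by (simp add: tail_def)
    then have "filterlim (\<lambda>i. nor (t' i)) at_top sequentially"
      by (rule filterlim_mono_eventually)
        (auto simp: t'_def eventually_sequentially intro!: exI[of _ n])
    then have t't: "tail (length u) t'"
      unfolding tail_def lu using Sigma_K Sigma_mdn K t'S dn by metis
    have "(v, \<lambda>i. t' (i + n)) \<in> above D" if v: "v \<in> ext u t' n" for v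
    proof -
      \<comment> \<open>Here \<open>pos (t0 i) \<subseteq> pos (s i)\<close> is used: the enlarged
        creatures lead only to stems that \<open>(u, s)\<close> allows, and from \<open>n\<close> on
        \<open>t'\<close> is \<open>s\<close>.\<close>
      have "v \<in> ext u s n"
        by (rule ext_mono[OF v]) (use t0 in \<open>auto simp: t'_def\<close>)
      then show ?thesis
        using above_mono[OF s(1) r_ext[OF sP]] by (simp add: t'_def)
    qed
    then have "captured D (a - \<epsilon> l) u t t'"
      unfolding captured_def using t't t'S t'n by blast
    then show "\<exists>x\<in>{}. compatible P r x (u, s)" using False by blast
  qed
  moreover have "a - \<epsilon> l \<le> nor (h i)" for i
    using hn[of i] a(2)[of i] by linarith
  ultimately show ?thesis using tl hS by blast
qed

text \<open>The stems are handled one by one, each lowering the guaranteed norm by at most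
  \<open>\<epsilon> l\<close>. Since \<open>card U * \<epsilon> l \<le> 1\<close>, a start at 3
  keeps the norms at 2 or more, as \<open>settle_one\<close> demands at every turn.\<close>

lemma settle_level:
  assumes t: "tail (m l) t" and a: "3 \<le> a" "\<And>i. a \<le> nor (t i)"
  shows "\<exists>t' B. tail (m l) t' \<and> (\<forall>i. t' i \<in> \<Sigma> (t i) \<and> a - 1 \<le> nor (t' i)) \<and> B \<subseteq> D \<and> finite B \<and>
    (\<forall>u\<in>seqs H (m l). settled D u t' B)"
proof -
  have fin: "finite (seqs H (m l))" using finite_seqs finH by blast
  have le: "card U * \<epsilon> l \<le> 1" if "U \<subseteq> seqs H (m l)" for U
  proof -
    have "real (card U) \<le> 1 / \<epsilon> l"
      using card_mono[OF fin that] card_le[of l] by linarith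
    then show ?thesis using eps_pos[of l] by (simp add: field_simps)
  qed
  have "\<exists>t' B. tail (m l) t' \<and> (\<forall>i. t' i \<in> \<Sigma> (t i) \<and> a - card U * \<epsilon> l \<le> nor (t' i)) \<and> B \<subseteq> D \<and>
    finite B \<and> (\<forall>u\<in>U. settled D u t' B)" if "U \<subseteq> seqs H (m l)" for U
    using finite_subset[OF that fin] that
  proof (induction U rule: finite_induct)
    case empty
    have "t i \<in> \<Sigma> (t i)" for i using t tail_K Sigma_refl by blast
    then show ?case using t a by (intro exI[of _ t] exI[of _ "{}"]) auto
  next
    case (insert u U)
    then obtain t1 B1 where t1: "tail (m l) t1" "\<And>i. t1 i \<in> \<Sigma> (t i)"
      "\<And>i. a - card U * \<epsilon> l \<le> nor (t1 i)" and B1: "B1 \<subseteq> D" "finite B1"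
      and s1: "\<And>u. u \<in> U \<Longrightarrow> settled D u t1 B1"
      by auto
    have "2 \<le> a - card U * \<epsilon> l" using le[of U] insert a by auto
    from settle_one[OF t1(1) this t1(3), of u D]
    obtain t2 B2 where t2: "tail (m l) t2" "\<And>i. t2 i \<in> \<Sigma> (t1 i)"
      "\<And>i. a - card U * \<epsilon> l - \<epsilon> l \<le> nor (t2 i)" and B2: "B2 \<subseteq> D" "finite B2" "settled D u t2 B2"
      using insert by auto
    have S: "t2 i \<in> \<Sigma> (t i)" for i
      using Sigma_trans[OF tail_K[OF t] t1(2) t2(2)] .
    have n: "a - card (insert u U) * \<epsilon> l \<le> nor (t2 i)" for i
      using t2(3)[of i] insert(1,2) by (simp add: algebra_simps)
    have "settled D v t2 (B1 \<union> B2)" if "v \<in> insert u U" for v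
    proof (cases "v = u")
      case True
      have "t2 i \<in> \<Sigma> (t2 i)" for i using t2 tail_K Sigma_refl by blast
      then show ?thesis using settled_mono[OF B2(3) t2(1), of t2] True by blast
    next
      case False
      then show ?thesis using settled_mono[OF s1 t1(1) t2(2)] that by blast
    qed
    then show ?case
      using t2(1) S n B1 B2 by (intro exI[of _ t2] exI[of _ "B1 \<union> B2"]) auto
  qed
  from this[of "seqs H (m l)"] obtain t' B where t': "tail (m l) t'" "\<And>i. t' i \<in> \<Sigma> (t i)"
    "\<And>i. a - card (seqs H (m l)) * \<epsilon> l \<le> nor (t' i)" "B \<subseteq> D" "finite B"
    "\<And>u. u \<in> seqs H (m l) \<Longrightarrow> settled D u t' B"
    by blast
  moreover have "a - 1 \<le> nor (t' i)" for i
    using t'(3)[of i] le[of "seqs H (m l)"] by auto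
  ultimately show ?thesis by blast
qed

text \<open>An unchanged creature may have any norm, while a changed one must keep norm at least
  \<open>n\<close>. This alternative lets the norms of a fusion still tend to infinity.\<close>

definition fusion_le :: "nat \<Rightarrow> 'a condition rel" where
  "fusion_le n = {((w, t), (w', t')). (w, t) \<in> P \<and> (w', t') \<in> P \<and> w' = w \<and> (\<forall>i<n. t' i = t i) \<and>
     (\<forall>i. t' i = t i \<or> t' i \<in> \<Sigma> (t i) \<and> real n \<le> nor (t' i))}"

lemma fusion_leE:
  assumes "((w, t), q) \<in> fusion_le n"
  obtains t' where "q = (w, t')" "(w, t) \<in> P" "(w, t') \<in> P" "\<And>i. i < n \<Longrightarrow> t' i = t i"
    "\<And>i. t' i = t i \<or> t' i \<in> \<Sigma> (t i) \<and> real n \<le> nor (t' i)"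
  using assms by (cases q) (auto simp: fusion_le_def)

lemma fusion_le_r:
  assumes "(p, q) \<in> fusion_le n" shows "(p, q) \<in> r"
proof -
  obtain w t where p: "p = (w, t)" by fastforce
  then obtain t' where q: "q = (w, t')" and P: "(w, t) \<in> P" "(w, t') \<in> P"
    and S: "\<And>i. t' i = t i \<or> t' i \<in> \<Sigma> (t i)"
    using assms fusion_leE by metis
  have "t' i \<in> \<Sigma> (t i)" for i
    using S[of i] Sigma_refl[of "t i"] tail_K P P_iff by metis
  then show ?thesis unfolding p q using r_pure P by blast
qed

lemma fusion_le_refl: "p \<in> P \<Longrightarrow> (p, p) \<in> fusion_le n"
  by (auto simp: fusion_le_def)

lemma fusion_le_mono: "n \<le> n' \<Longrightarrow> fusion_le n' \<subseteq> fusion_le n"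
  by (fastforce simp: fusion_le_def)

lemma fusion_le_trans:
  assumes "(p, q) \<in> fusion_le n" "(q, s) \<in> fusion_le n"
  shows "(p, s) \<in> fusion_le n"
proof -
  obtain w t where p: "p = (w, t)" by fastforce
  obtain t' where t': "q = (w, t')" "(w, t) \<in> P" "\<And>i. i < n \<Longrightarrow> t' i = t i"
    "\<And>i. t' i = t i \<or> t' i \<in> \<Sigma> (t i) \<and> real n \<le> nor (t' i)"
    using assms(1) unfolding p by (rule fusion_leE) blast
  obtain t'' where t'': "s = (w, t'')" "(w, t'') \<in> P" "\<And>i. i < n \<Longrightarrow> t'' i = t' i"
    "\<And>i. t'' i = t' i \<or> t'' i \<in> \<Sigma> (t' i) \<and> real n \<le> nor (t'' i)"
    using assms(2) unfolding t'(1) by (rule fusion_leE) blast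
  have "t'' i = t i \<or> t'' i \<in> \<Sigma> (t i) \<and> real n \<le> nor (t'' i)" for i
    using t'(4)[of i] t''(4)[of i] Sigma_trans[of "t i" "t' i" "t'' i"] tail_K t'(2) P_iff by metis
  then show ?thesis unfolding p t''(1) fusion_le_def using t'(2,3) t''(2,3) by simp
qed

lemma fusion:
  assumes f: "\<And>j. (f j, f (Suc j)) \<in> fusion_le (n + j)"
  shows "\<exists>q\<in>P. \<forall>j. (f j, q) \<in> fusion_le (n + j)"
proof -
  have fP: "f j \<in> P" for j using f[of j] by (auto simp: fusion_le_def)
  have chain: "(f j, f (j + k)) \<in> fusion_le (n + j)" for j k
  proof (induction k)
    case (Suc k)
    have "(f (j + k), f (j + Suc k)) \<in> fusion_le (n + j)"
      using f[of "j + k"] fusion_le_mono[of "n + j" "n + (j + k)"] by auto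
    with Suc show ?case using fusion_le_trans by blast
  qed (use fP fusion_le_refl in simp)
  define w where "w = fst (f 0)"
  define t where "t j = snd (f j)" for j
  have "fst (f j) = w" for j
    using chain[of 0 j] by (auto simp: fusion_le_def w_def)
  then have fe: "f j = (w, t j)" for j
    unfolding t_def by (metis prod.collapse)
  \<comment> \<open>From stage \<open>Suc i\<close> on, all indices below \<open>n + Suc i\<close>
    are frozen, among them \<open>i\<close>.\<close>
  define T where "T i = t (Suc i) i" for i
  have step: "T i = t j i \<or> T i \<in> \<Sigma> (t j i) \<and> real (n + j) \<le> nor (T i)" for i j
  proof (cases "j \<le> Suc i")
    case True
    then show ?thesis using chain[of j "Suc i - j"] by (auto simp: fe T_def fusion_le_def)
  next
    case False
    then show ?thesis using chain[of "Suc i" "j - Suc i"] by (auto simp: fe T_def fusion_le_def)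
  qed
  have eq: "T i = t j i" if "i < n + j" for i j
  proof (cases "j \<le> Suc i")
    case True
    then show ?thesis using that chain[of j "Suc i - j"] by (auto simp: fe T_def fusion_le_def)
  next
    case False
    then show ?thesis using chain[of "Suc i" "j - Suc i"] by (auto simp: fe T_def fusion_le_def)
  qed
  have tl: "tail (length w) (t j)" and wH: "w \<in> seqs H (length w)" for j
    using fP[of j] P_iff unfolding fe by blast+
  have TK: "T i \<in> K" "mdn (T i) = length w + i" for i
    using tl[of "Suc i"] by (auto simp: tail_def T_def)
  have "filterlim (\<lambda>i. nor (T i)) at_top sequentially"
    unfolding filterlim_at_top eventually_sequentially
  proof
    fix Z :: real
    \<comment> \<open>Compare with stage \<open>b\<close>: either \<open>T i\<close> is still
      \<open>t b i\<close>, whose norm is large for large \<open>i\<close>, or it was changed later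
      and has norm at least \<open>n + b\<close>.\<close>
    obtain b :: nat where b: "Z \<le> b" using real_arch_simple by blast
    obtain k where k: "\<And>i. k \<le> i \<Longrightarrow> Z \<le> nor (t b i)" using tail_nor[OF tl] by blast
    have "Z \<le> nor (T i)" if "k \<le> i" for i
      using step[of i b] k[OF that] b by auto
    then show "\<exists>k. \<forall>i\<ge>k. Z \<le> nor (T i)" by blast
  qed
  then have "(w, T) \<in> P"
    unfolding P_iff tail_def using TK wH by blast
  moreover have "((w, t j), (w, T)) \<in> fusion_le (n + j)" for j
    unfolding fusion_le_def using fP[of j] \<open>(w, T) \<in> P\<close> step eq unfolding fe by auto
  ultimately show ?thesis
    unfolding fe by blast
qed

section \<open>Making countably many members of one dense set predense\<close>

lemma stage:
  assumes p: "p \<in> P"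
  shows "\<exists>q l B. (p, q) \<in> fusion_le n \<and> n \<le> m l \<and> B \<subseteq> D \<and> finite B \<and>
    (\<forall>u s. (q, (u, s)) \<in> r \<and> length u = m l \<and> (u, s) \<in> above D \<and> (\<forall>i. 1 < nor (s i)) \<longrightarrow>
       (\<exists>x\<in>B. compatible P r x (u, s)))"
proof -
  obtain w t where e: "p = (w, t)" by fastforce
  have w: "w \<in> seqs H (length w)" and t: "tail (length w) t" using p P_iff e by blast+
  obtain k where k: "\<And>i. k \<le> i \<Longrightarrow> real n + 3 \<le> nor (t i)" using tail_nor[OF t] by blast
  \<comment> \<open>As \<open>l \<le> m l\<close>, the level lies at least \<open>k + n\<close>
    above the stem: the first \<open>n\<close> creatures remain untouched, and all creatures to be
    changed have norm at least \<open>n + 3\<close>. The 3 is what \<open>settle_level\<close>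
    needs; at most 1 of it is lost.\<close>
  define l where "l = length w + k + n"
  define c where "c = m l - length w"
  have lm: "l \<le> m l" using m_mono strict_mono_imp_increasing by blast
  then have c: "m l = length w + c" "k \<le> c" "n \<le> c" unfolding l_def c_def by auto
  have t1: "tail (m l) (\<lambda>i. t (i + c))" unfolding c(1) by (rule tail_shift[OF t])
  obtain t' B where t': "tail (m l) t'" "\<And>i. t' i \<in> \<Sigma> (t (i + c))" "\<And>i. real n + 3 - 1 \<le> nor (t' i)"
    and B: "B \<subseteq> D" "finite B" "\<And>u. u \<in> seqs H (m l) \<Longrightarrow> settled D u t' B"
    using settle_level[OF t1, of "real n + 3" D] k c by auto
  define T where "T i = (if i < c then t i else t' (i - c))" for i
  have TS: "T i = t i \<or> T i \<in> \<Sigma> (t i) \<and> real n \<le> nor (T i)" for i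
    using t'(2)[of "i - c"] t'(3)[of "i - c"] by (auto simp: T_def)
  have "T i \<in> K \<and> mdn (T i) = length w + i" for i
    using t'(1) t c by (auto simp: T_def tail_def)
  moreover have "filterlim (\<lambda>i. nor (T i)) at_top sequentially"
  proof -
    have "filterlim (\<lambda>i. nor (T (i + c))) at_top sequentially"
      using t'(1) by (simp add: T_def tail_def)
    then show ?thesis
      using eventually_sequentially_seg[of "\<lambda>i. Z \<le> nor (T i)" c for Z] by (simp add: filterlim_at_top)
  qed
  ultimately have TP: "(w, T) \<in> P" unfolding P_iff tail_def using w by blast
  have f: "(p, (w, T)) \<in> fusion_le n"
  proof -
    have "T i = t i" if "i < n" for i using that c(3) by (simp add: T_def)
    then show ?thesis
      unfolding fusion_le_def e using TP p TS unfolding e by blast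
  qed
  have "\<exists>x\<in>B. compatible P r x (u, s)"
    if us: "((w, T), (u, s)) \<in> r" "length u = m l" "(u, s) \<in> above D" "\<forall>i. 1 < nor (s i)" for u s
  proof -
    obtain n' where n': "u \<in> ext w T n'" "\<And>i. s i \<in> \<Sigma> (T (i + n'))"
      using us(1) unfolding r_iff by blast
    then have "n' = c" using us(2) c(1) length_ext by fastforce
    then have "s i \<in> \<Sigma> (t' i)" for i using n'(2)[of i] by (simp add: T_def)
    moreover have "u \<in> seqs H (m l)" using above_P[OF us(3)] us(2) P_iff by metis
    ultimately show ?thesis using B(3)[of u] us unfolding settled_def by blast
  qed
  then show ?thesis using f B lm unfolding l_def[symmetric]
    by (intro exI[of _ "(w, T)"] exI[of _ l] exI[of _ B]) (auto simp: l_def)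
qed

text \<open>The same \<open>D\<close> is treated at every stage, on levels at height
  \<open>n + j\<close> or more. Above any \<open>s\<close> there is a member of \<open>D\<close>;
  prolonged to a treated level, it is a condition to which that stage applies, and the resulting
  compatibility is inherited by \<open>s\<close>.\<close>

lemma countable_predense:
  assumes p: "p \<in> P" and D: "dense_in P r D"
  shows "\<exists>q B. (p, q) \<in> fusion_le n \<and> B \<subseteq> D \<and> countable B \<and>
    (\<forall>s\<in>P. (q, s) \<in> r \<longrightarrow> (\<exists>x\<in>B. compatible P r x s))"
proof -
  define G where "G k q q' l B \<longleftrightarrow> (q, q') \<in> fusion_le k \<and> k \<le> m l \<and> B \<subseteq> D \<and> finite B \<and>
    (\<forall>u s. (q', (u, s)) \<in> r \<and> length u = m l \<and> (u, s) \<in> above D \<and> (\<forall>i. 1 < nor (s i)) \<longrightarrow>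
       (\<exists>x\<in>B. compatible P r x (u, s)))" for k q q' l B
  have "\<exists>q' l B. G k q q' l B" if "q \<in> P" for k q
    unfolding G_def by (rule stage[OF that])
  then have "\<forall>k q. \<exists>q' l B. q \<in> P \<longrightarrow> G k q q' l B" by blast
  then obtain q' l B where G: "\<And>k q. q \<in> P \<Longrightarrow> G k q (q' k q) (l k q) (B k q)"
    unfolding choice_iff by blast
  define f where "f = rec_nat p (\<lambda>j. q' (n + j))"
  have f0: "f 0 = p" and fS: "f (Suc j) = q' (n + j) (f j)" for j by (simp_all add: f_def)
  have fP: "f j \<in> P" for j
  proof (induction j)
    case (Suc j)
    then have "(f j, f (Suc j)) \<in> fusion_le (n + j)" using G[of "f j" "n + j"] by (simp add: fS G_def)
    then show ?case by (auto simp: fusion_le_def)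
  qed (use p f0 in simp)
  have Gf: "G (n + j) (f j) (f (Suc j)) (l (n + j) (f j)) (B (n + j) (f j))" for j
    using G[OF fP] by (simp add: fS)
  obtain q where q: "q \<in> P" "\<And>j. (f j, q) \<in> fusion_le (n + j)"
    using fusion[of f n] Gf unfolding G_def by blast
  define C where "C = (\<Union>j. B (n + j) (f j))"
  have C: "C \<subseteq> D" "countable C"
    using Gf unfolding C_def G_def by (auto intro!: countable_UN intro: countable_finite)
  have "\<exists>x\<in>C. compatible P r x s" if s: "s \<in> P" "(q, s) \<in> r" for s
  proof -
    obtain d where d: "d \<in> D" "(s, d) \<in> r" using D s by (auto simp: dense_in_def)
    obtain w t where e: "d = (w, t)" by fastforce
    have dP: "(w, t) \<in> P" using d e r_subset by blast
    obtain k where k: "\<And>i. k \<le> i \<Longrightarrow> 2 \<le> nor (t i)" using tail_nor dP P_iff by blast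
    \<comment> \<open>Stage \<open>j\<close> treats a level of height at least \<open>n + j\<close>,
      so it is not below the stem of \<open>d\<close>, and from it on all norms of \<open>d\<close>
      are at least 2.\<close>
    define j where "j = length w + k"
    define c where "c = m (l (n + j) (f j)) - length w"
    have "n + j \<le> m (l (n + j) (f j))" using Gf unfolding G_def by blast
    then have c: "m (l (n + j) (f j)) = length w + c" "k \<le> c" unfolding c_def j_def by auto
    obtain v where v: "v \<in> ext w t c" using ext_exists dP P_iff by blast
    define s' where "s' = (\<lambda>i. t (i + c))"
    have ds': "((w, t), (v, s')) \<in> r" unfolding s'_def by (rule r_ext[OF dP v])
    have "(d, d) \<in> r" using d r_subset r_preorder by (auto simp: preorder_on_def refl_on_def)
    then have "(v, s') \<in> above D" using ds' d e by (auto simp: above_def)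
    moreover have "length v = m (l (n + j) (f j))" using v length_ext c by metis
    moreover have "1 < nor (s' i)" for i using k[of "i + c"] c(2) by (auto simp: s'_def)
    moreover have ss': "(s, (v, s')) \<in> r" using d e ds' r_trans by (meson transD)
    have "(f (Suc j), (v, s')) \<in> r"
      using fusion_le_r[OF q(2)] s(2) ss' r_trans by (meson transD)
    ultimately obtain x where "x \<in> B (n + j) (f j)" "compatible P r x (v, s')"
      using Gf[of j] unfolding G_def by blast
    then show ?thesis
      using ss' r_trans unfolding C_def compatible_def by (meson UN_I UNIV_I transD)
  qed
  moreover have "(p, q) \<in> fusion_le n" using q(2)[of 0] f0 by simp
  ultimately show ?thesis using C by blast
qed

end

theorem theorem3p3:
  fixes H :: "nat \<Rightarrow> 'a set"
    and \<epsilon> :: "nat \<Rightarrow> real"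
    and m :: "nat \<Rightarrow> nat"
    and K :: "'a creature set"
    and \<Sigma> :: "'a creature \<Rightarrow> 'a creature set"
  assumes "\<And>n. finite (H n) \<and> 2 \<le> card (H n)"
    and "\<And>i. 0 < \<epsilon> i" and "decseq \<epsilon>"
    and "strict_mono m" and "m 0 = 0"
    and "\<And>i. real (card (seqs H (m i))) \<le> 1 / \<epsilon> i"
    and "good_creating_pair H K \<Sigma>"
    and "local_pair K"
    and "forgetful H K"
    and "halving_property K \<Sigma> \<epsilon> m"
  shows "proper_forcing TYPE('v) (Q_conds H K) (Q_le H K \<Sigma>)"
proof -
  interpret halving_pair H K \<Sigma> \<epsilon> m
    by unfold_locales (use assms in auto)
  show ?thesis
  proof (rule proper_forcing_if_fusion[where R = fusion_le])
    show "\<exists>q\<in>P. \<forall>j. (f j, q) \<in> r" if "\<And>j. (f j, f (Suc j)) \<in> fusion_le (n + j)" for f n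
      using fusion[of f n, OF that] fusion_le_r by blast
  qed (use r_preorder fusion_le_refl fusion_le_r countable_predense in auto)
qed

end
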